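(* Let $\{X_t\}_{t\in\mathbb Z}$ be a strictly stationary functional time series with values in $L^2([0,1],\mathbb R)$, $\mathbb E\|X_0\|_2^2<\infty$ and $\sum_{t\in\mathbb Z}\|r_t\|_2<\infty$, where $r_t$ is the autocovariance kernel at lag $t$. Let $f_\omega$ and $\mathcal F_\omega$ be its spectral density kernel and operator, and let $\widetilde{\mathcal F}$ be the integral operator with kernel $\tilde f=\frac1{2\pi}\int_{-\pi}^{\pi}f_\omega\,d\omega$. Then the minimal distance $M^2(\widetilde{\mathcal F})=\int_{-\pi}^{\pi}|||\mathcal F_\omega-\widetilde{\mathcal F}|||_2^2\,d\omega$ is given by $$M^2(\widetilde{\mathcal F})=\int_0^1\int_0^1\int_{-\pi}^\pi|f_\omega(\tau,\sigma)|^2\,d\omega\, d\tau\, d\sigma-\frac1{2\pi}\int_0^1\int_0^1\Bigl|\int_{-\pi}^\pi f_\omega(\tau,\sigma)\,d\omega\Bigr|^2d\tau\, d\sigma .$$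
   Context: $\|\cdot\|_2$ is the norm of $L^2([0,1]^k)$. With $\mu(\tau)=\mathbb E X_0(\tau)$, the autocovariance kernel at lag $t$ is $r_t(\tau,\sigma)=\mathbb E[(X_{t+s}(\tau)-\mu(\tau))(X_s(\sigma)-\mu(\sigma))]\in L^2([0,1]^2,\mathbb R)$. The spectral density kernel is $f_\omega=\frac1{2\pi}\sum_{t\in\mathbb Z}e^{-i\omega t}r_t$, with convergence in $L^2([0,1]^2,\mathbb C)$. The spectral density operator $\mathcal F_\omega:L^2([0,1],\mathbb R)\to L^2([0,1],\mathbb C)$ is $\mathcal F_\omega h(\tau)=\int_0^1 f_\omega(\tau,\sigma)h(\sigma)\,d\sigma$, and $\widetilde{\mathcal F}h(\tau)=\int_0^1\tilde f(\tau,\sigma)h(\sigma)\,d\sigma$. $|||\cdot|||_2$ is the Hilbert-Schmidt norm; for an integral operator it equals the $L^2([0,1]^2)$ norm of the kernel. *)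

theory Defs
  imports "HOL-Probability.Probability"
begin

section \<open>Square-integrable functions\<close>

text \<open>Elements of \<open>L\<^sup>2\<close> are represented by functions, not by their classes modulo
  almost everywhere equality.\<close>

definition L2 :: "'a measure \<Rightarrow> ('a \<Rightarrow> 'b::real_normed_vector) set" where
  "L2 M = {h. h \<in> borel_measurable M \<and> integrable M (\<lambda>x. (norm (h x))\<^sup>2)}"

definition L2_norm :: "'a measure \<Rightarrow> ('a \<Rightarrow> 'b::real_normed_vector) \<Rightarrow> real" where
  "L2_norm M h = sqrt (LINT x|M. (norm (h x))\<^sup>2)"

text \<open>The Borel \<open>\<sigma>\<close>-algebra of the norm topology. Open sets are unions of classes modulo
  almost everywhere equality, so this is the Borel \<open>\<sigma>\<close>-algebra of the quotient space,
  pulled back to representatives.\<close>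

definition L2_borel :: "'a measure \<Rightarrow> ('a \<Rightarrow> 'b::real_normed_vector) measure" where
  "L2_borel M = sigma (L2 M) {U. U \<subseteq> L2 M \<and>
     (\<forall>g\<in>U. \<exists>\<epsilon>>0. \<forall>h\<in>L2 M. L2_norm M (\<lambda>x. h x - g x) < \<epsilon> \<longrightarrow> h \<in> U)}"

abbreviation unit_interval :: "real measure" where
  "unit_interval \<equiv> restrict_space lborel {0..1}"

abbreviation unit_square :: "(real \<times> real) measure" where
  "unit_square \<equiv> unit_interval \<Otimes>\<^sub>M unit_interval"

section \<open>Functional time series\<close>

text \<open>Each \<open>X t\<close> is a random element of \<open>L\<^sup>2([0,1], \<real>)\<close>. Point evaluation, which occurs in
  the mean function and the autocovariance kernels, is not defined on \<open>L\<^sup>2\<close>; as usual the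
  representatives are taken to be jointly measurable (every random element of
  \<open>L\<^sup>2([0,1], \<real>)\<close> has such a version).\<close>

definition functional_time_series :: "'w measure \<Rightarrow> (int \<Rightarrow> 'w \<Rightarrow> real \<Rightarrow> real) \<Rightarrow> bool" where
  "functional_time_series P X \<longleftrightarrow>
     (\<forall>t. X t \<in> measurable P (L2_borel unit_interval) \<and>
          (\<lambda>(w, \<tau>). X t w \<tau>) \<in> borel_measurable (P \<Otimes>\<^sub>M unit_interval))"

definition strictly_stationary :: "'w measure \<Rightarrow> (int \<Rightarrow> 'w \<Rightarrow> real \<Rightarrow> real) \<Rightarrow> bool" where
  "strictly_stationary P X \<longleftrightarrow>
     (\<forall>J h. finite J \<longrightarrow>
        distr P (PiM J (\<lambda>_. L2_borel unit_interval)) (\<lambda>w. \<lambda>t\<in>J. X (t + h) w) =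
        distr P (PiM J (\<lambda>_. L2_borel unit_interval)) (\<lambda>w. \<lambda>t\<in>J. X t w))"

definition mean_function :: "'w measure \<Rightarrow> (int \<Rightarrow> 'w \<Rightarrow> real \<Rightarrow> real) \<Rightarrow> real \<Rightarrow> real" where
  "mean_function P X \<tau> = (LINT w|P. X 0 w \<tau>)"

text \<open>By stationarity the covariance of \<open>X (t + s)\<close> and \<open>X s\<close> does not depend on \<open>s\<close>;
  we take \<open>s = 0\<close>.\<close>

definition autocov_kernel ::
    "'w measure \<Rightarrow> (int \<Rightarrow> 'w \<Rightarrow> real \<Rightarrow> real) \<Rightarrow> int \<Rightarrow> real \<times> real \<Rightarrow> real" where
  "autocov_kernel P X t = (\<lambda>(\<tau>, \<sigma>).
     LINT w|P. (X t w \<tau> - mean_function P X \<tau>) * (X 0 w \<sigma> - mean_function P X \<sigma>))"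

text \<open>The series over \<open>\<int>\<close> converges in \<open>L\<^sup>2([0,1]\<^sup>2, \<complex>)\<close>, along the net of finite index sets
  as for \<^const>\<open>has_sum\<close>. It determines each \<open>f \<omega>\<close> only almost everywhere; the versions are
  taken jointly measurable, so that \<open>f \<omega> (\<tau>, \<sigma>)\<close> can be integrated over \<open>\<omega>\<close>.\<close>

definition spectral_density_kernel ::
    "'w measure \<Rightarrow> (int \<Rightarrow> 'w \<Rightarrow> real \<Rightarrow> real) \<Rightarrow> (real \<Rightarrow> real \<times> real \<Rightarrow> complex) \<Rightarrow> bool" where
  "spectral_density_kernel P X f \<longleftrightarrow>
     (\<lambda>(\<omega>, x). f \<omega> x) \<in> borel_measurable (lborel \<Otimes>\<^sub>M unit_square) \<and>
     (\<forall>\<omega>. f \<omega> \<in> L2 unit_square \<and>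
        ((\<lambda>S. L2_norm unit_square (\<lambda>x. f \<omega> x -
             1 / complex_of_real (2 * pi) *
               (\<Sum>t\<in>S. exp (- \<i> * complex_of_real \<omega> * of_int t) *
                 complex_of_real (autocov_kernel P X t x))))
          \<longlongrightarrow> 0) (finite_subsets_at_top UNIV))"

definition mean_kernel :: "(real \<Rightarrow> real \<times> real \<Rightarrow> complex) \<Rightarrow> real \<times> real \<Rightarrow> complex" where
  "mean_kernel f x = 1 / complex_of_real (2 * pi) * (LINT \<omega>:{-pi..pi}|lborel. f \<omega> x)"

section \<open>Operators from \<open>L\<^sup>2([0,1], \<real>)\<close> to \<open>L\<^sup>2([0,1], \<complex>)\<close>\<close>

definition integral_operator ::
    "(real \<times> real \<Rightarrow> complex) \<Rightarrow> (real \<Rightarrow> real) \<Rightarrow> real \<Rightarrow> complex" where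
  "integral_operator k h \<tau> = (LINT \<sigma>|unit_interval. k (\<tau>, \<sigma>) * complex_of_real (h \<sigma>))"

definition orthonormal_basis :: "(nat \<Rightarrow> real \<Rightarrow> real) \<Rightarrow> bool" where
  "orthonormal_basis e \<longleftrightarrow>
     (\<forall>i. e i \<in> L2 unit_interval) \<and>
     (\<forall>i j. (LINT x|unit_interval. e i x * e j x) = (if i = j then 1 else 0)) \<and>
     (\<forall>h\<in>L2 unit_interval.
        (\<lambda>n. L2_norm unit_interval
           (\<lambda>x. h x - (\<Sum>i<n. (LINT y|unit_interval. h y * e i y) * e i x))) \<longlonglongrightarrow> 0)"

text \<open>The choice of the basis is immaterial: the Hilbert-Schmidt norm is the same for all
  orthonormal bases.\<close>

definition basis :: "nat \<Rightarrow> real \<Rightarrow> real" where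
  "basis = (SOME e. orthonormal_basis e)"

definition HS_norm :: "((real \<Rightarrow> real) \<Rightarrow> real \<Rightarrow> complex) \<Rightarrow> real" where
  "HS_norm T = sqrt (\<Sum>i. (L2_norm unit_interval (T (basis i)))\<^sup>2)"

definition hilbert_schmidt :: "((real \<Rightarrow> real) \<Rightarrow> real \<Rightarrow> complex) \<Rightarrow> bool" where
  "hilbert_schmidt T \<longleftrightarrow>
     (\<forall>h\<in>L2 unit_interval. T h \<in> L2 unit_interval) \<and>
     (\<forall>g\<in>L2 unit_interval. \<forall>h\<in>L2 unit_interval. \<forall>a b.
        AE \<tau> in unit_interval. T (\<lambda>x. a * g x + b * h x) \<tau> = complex_of_real a * T g \<tau> + complex_of_real b * T h \<tau>) \<and>
     (\<exists>C. \<forall>h\<in>L2 unit_interval. L2_norm unit_interval (T h) \<le> C * L2_norm unit_interval h) \<and>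
     summable (\<lambda>i. (L2_norm unit_interval (T (basis i)))\<^sup>2)"

text \<open>\<open>M\<^sup>2(G)\<close>, the squared distance of the family \<open>F \<omega>\<close> to an operator \<open>G\<close> that does not
  depend on the frequency.\<close>

definition M2 :: "(real \<Rightarrow> (real \<Rightarrow> real) \<Rightarrow> real \<Rightarrow> complex) \<Rightarrow>
    ((real \<Rightarrow> real) \<Rightarrow> real \<Rightarrow> complex) \<Rightarrow> real" where
  "M2 F G = (LINT \<omega>:{-pi..pi}|lborel. (HS_norm (\<lambda>h \<tau>. F \<omega> h \<tau> - G h \<tau>))\<^sup>2)"

end

(* By Parseval in the second variable, the Hilbert-Schmidt norm of an integral operator is the L2 norm
   of its kernel, so M2 at the mean kernel is the integrated variance of the frequency-dependent
   kernel, which gives the formula. A competing Hilbert-Schmidt operator G need not be given by a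
   kernel; it is compared basis vector by basis vector: for almost every tau the constant closest in
   mean square to the function omega |-> (F_omega e_i)(tau) is its mean, which by Fubini is the value
   at tau of the mean operator applied to e_i. All integrals are finite because the summability of the
   autocovariances bounds the L2 norms of the f_omega uniformly in omega. *)
theory Submission
  imports Defs
begin

section \<open>Square-integrable functions\<close>

text \<open>The obstacle throughout is default values. The Bochner integral of a non-integrable
  function is 0, so a finite \<open>L2_norm\<close>, a summable family of norms or a small
  \<open>M2\<close> says nothing until integrability is known. Hence the autocovariance kernels are
  put into L2 from the second moment and stationarity, and \<open>M2\<close> of every competitor is
  shown to be the integral of a bounded measurable function. Sums and integrals are mostly exchanged
  in \<open>ennreal\<close>, where Tonelli needs no finiteness. \<open>HS_norm\<close> refers to a
  basis picked by \<open>SOME\<close>, about which nothing is known until an orthonormal basis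
  exists; one is built by orthogonalising the monomials, and its completeness is the density of the
  polynomials in L2. Since functions are representatives, kernel operators are linear only almost
  everywhere, which L2 norms do not notice. The uniform bound on the \<open>f \<omega>\<close> is
  1/(2 pi) times the sum of the norms of the autocovariances, because the factors exp(-i omega t)
  have modulus 1.\<close>

lemma L2D:
  assumes "h \<in> L2 M"
  shows L2_measurable: "h \<in> borel_measurable M"
    and L2_integrable: "integrable M (\<lambda>x. (norm (h x))\<^sup>2)"
  using assms by (auto simp: L2_def)

lemma L2I_nn_integral:
  assumes "h \<in> borel_measurable M" "(\<integral>\<^sup>+x. ennreal ((norm (h x))\<^sup>2) \<partial>M) < \<infinity>"
  shows "h \<in> L2 M"
  using assms unfolding L2_def by (auto simp: integrable_iff_bounded)

lemma L2_norm_nonneg [simp]: "0 \<le> L2_norm M h"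
  by (simp add: L2_norm_def)

lemma L2_norm_square: "(L2_norm M h)\<^sup>2 = (LINT x|M. (norm (h x))\<^sup>2)"
  by (simp add: L2_norm_def)

text \<open>The bridge to \<open>ennreal\<close>. Membership matters: for measurable
  \<open>h\<close> with non-integrable square the left side is infinite while \<open>L2_norm\<close>
  defaults to 0.\<close>

lemma L2_nn_integral:
  assumes "h \<in> L2 M"
  shows "(\<integral>\<^sup>+x. ennreal ((norm (h x))\<^sup>2) \<partial>M) = ennreal ((L2_norm M h)\<^sup>2)"
  unfolding L2_norm_square using L2_integrable[OF assms] by (intro nn_integral_eq_integral) auto

lemma L2_norm_cong_AE:
  assumes "AE x in M. g x = h x" "g \<in> borel_measurable M" "h \<in> borel_measurable M"
  shows "L2_norm M g = L2_norm M h"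
  unfolding L2_norm_def using assms(2,3)
  by (intro arg_cong[where f = sqrt] integral_cong_AE) (use assms(1) in auto)

lemma norm_add_square_le:
  fixes a b :: "'b::real_normed_vector"
  shows "(norm (a + b))\<^sup>2 \<le> 2 * (norm a)\<^sup>2 + 2 * (norm b)\<^sup>2"
proof -
  have "(norm (a + b))\<^sup>2 \<le> (norm a + norm b)\<^sup>2"
    by (intro power_mono norm_triangle_ineq) auto
  also have "\<dots> \<le> 2 * (norm a)\<^sup>2 + 2 * (norm b)\<^sup>2"
    using sum_squares_bound[of "norm a" "norm b"] by (simp add: power2_sum)
  finally show ?thesis .
qed

lemma norm_diff_square_le:
  fixes a b :: "'b::real_normed_vector"
  shows "(norm (a - b))\<^sup>2 \<le> 2 * (norm a)\<^sup>2 + 2 * (norm b)\<^sup>2"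
  using norm_add_square_le[of a "- b"] by simp

section \<open>L2 as a vector space, Cauchy-Schwarz and the triangle inequality\<close>

lemma L2_add:
  fixes g h :: "'a \<Rightarrow> 'b::{real_normed_vector,second_countable_topology}"
  assumes "g \<in> L2 M" "h \<in> L2 M"
  shows "(\<lambda>x. g x + h x) \<in> L2 M"
proof -
  note [measurable] = L2_measurable[OF assms(1)] L2_measurable[OF assms(2)]
  have "integrable M (\<lambda>x. (norm (g x + h x))\<^sup>2)"
    by (rule Bochner_Integration.integrable_bound[where f = "\<lambda>x. 2 * (norm (g x))\<^sup>2 + 2 * (norm (h x))\<^sup>2"])
       (use L2_integrable[OF assms(1)] L2_integrable[OF assms(2)] norm_add_square_le in auto)
  then show ?thesis
    by (simp add: L2_def)
qed

lemma L2_mult_left: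
  fixes h :: "'a \<Rightarrow> 'b::{real_normed_div_algebra,second_countable_topology}"
  assumes "h \<in> L2 M"
  shows "(\<lambda>x. c * h x) \<in> L2 M"
  using L2D[OF assms] by (auto simp: L2_def norm_mult power_mult_distrib)

lemma L2_diff:
  fixes g h :: "'a \<Rightarrow> 'b::{real_normed_div_algebra,second_countable_topology}"
  assumes "g \<in> L2 M" "h \<in> L2 M"
  shows "(\<lambda>x. g x - h x) \<in> L2 M"
  using L2_add[OF assms(1) L2_mult_left[OF assms(2), of "-1"]] by simp

lemma L2_zero [simp]: "(\<lambda>x. 0) \<in> L2 M"
  by (simp add: L2_def)

lemma L2_sum:
  fixes h :: "'i \<Rightarrow> 'a \<Rightarrow> 'b::{real_normed_vector,second_countable_topology}"
  assumes "\<And>i. i \<in> S \<Longrightarrow> h i \<in> L2 M"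
  shows "(\<lambda>x. \<Sum>i\<in>S. h i x) \<in> L2 M"
  using assms by (induction S rule: infinite_finite_induct) (auto intro: L2_add)

lemma L2_bounded:
  assumes "finite_measure M" "h \<in> borel_measurable M" "\<And>x. x \<in> space M \<Longrightarrow> norm (h x) \<le> C"
  shows "h \<in> L2 M"
proof -
  interpret finite_measure M by fact
  have "integrable M (\<lambda>x. (norm (h x))\<^sup>2)"
    by (rule integrable_const_bound[where B = "C\<^sup>2"]) (use assms in \<open>auto intro!: AE_I2 power_mono\<close>)
  then show ?thesis
    using assms by (simp add: L2_def)
qed

lemma L2_mult_integrable:
  fixes g h :: "'a \<Rightarrow> 'b::{real_normed_div_algebra,banach,second_countable_topology}"
  assumes "g \<in> L2 M" "h \<in> L2 M"
  shows "integrable M (\<lambda>x. g x * h x)"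
proof -
  note [measurable] = L2_measurable[OF assms(1)] L2_measurable[OF assms(2)]
  show ?thesis
  proof (rule Bochner_Integration.integrable_bound)
    show "integrable M (\<lambda>x. (norm (g x))\<^sup>2 + (norm (h x))\<^sup>2)"
      using L2_integrable[OF assms(1)] L2_integrable[OF assms(2)] by simp
    show "AE x in M. norm (g x * h x) \<le> norm ((norm (g x))\<^sup>2 + (norm (h x))\<^sup>2)"
    proof (rule AE_I2)
      fix x
      have "norm (g x) * norm (h x) \<le> (norm (g x))\<^sup>2 + (norm (h x))\<^sup>2"
        using sum_squares_bound[of "norm (g x)" "norm (h x)"]
          mult_nonneg_nonneg[OF norm_ge_zero[of "g x"] norm_ge_zero[of "h x"]] by linarith
      then show "norm (g x * h x) \<le> norm ((norm (g x))\<^sup>2 + (norm (h x))\<^sup>2)"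
        by (simp add: norm_mult)
    qed
  qed measurable
qed

text \<open>Cauchy-Schwarz, pulled back from its version for nonnegative integrals by comparing
  squares.\<close>

lemma L2_norm_inner_le:
  fixes g h :: "'a \<Rightarrow> 'b::{real_normed_div_algebra,banach,second_countable_topology}"
  assumes "g \<in> L2 M" "h \<in> L2 M"
  shows "(LINT x|M. norm (g x) * norm (h x)) \<le> L2_norm M g * L2_norm M h"
proof -
  note [measurable] = L2_measurable[OF assms(1)] L2_measurable[OF assms(2)]
  have int: "integrable M (\<lambda>x. norm (g x) * norm (h x))"
    using integrable_norm[OF L2_mult_integrable[OF assms]] by (simp add: norm_mult)
  have "ennreal ((LINT x|M. norm (g x) * norm (h x))\<^sup>2)
      = (\<integral>\<^sup>+x. ennreal (norm (g x) * norm (h x)) \<partial>M)\<^sup>2"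
    by (subst nn_integral_eq_integral[OF int]) (auto simp: ennreal_power)
  also have "\<dots> = (\<integral>\<^sup>+x. ennreal (norm (g x)) * ennreal (norm (h x)) \<partial>M)\<^sup>2"
    by (simp add: ennreal_mult)
  also have "\<dots> \<le> (\<integral>\<^sup>+x. (ennreal (norm (g x)))\<^sup>2 \<partial>M) * (\<integral>\<^sup>+x. (ennreal (norm (h x)))\<^sup>2 \<partial>M)"
    by (rule Cauchy_Schwarz_nn_integral) auto
  also have "\<dots> = ennreal ((L2_norm M g * L2_norm M h)\<^sup>2)"
    unfolding ennreal_power[OF norm_ge_zero] L2_nn_integral[OF assms(1)] L2_nn_integral[OF assms(2)]
      power_mult_distrib by (simp add: ennreal_mult)
  finally have "(LINT x|M. norm (g x) * norm (h x))\<^sup>2 \<le> (L2_norm M g * L2_norm M h)\<^sup>2"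
    by simp
  then show ?thesis
    by (rule power2_le_imp_le) simp
qed

lemma L2_norm_triangle:
  fixes g h :: "'a \<Rightarrow> 'b::{real_normed_div_algebra,banach,second_countable_topology}"
  assumes "g \<in> L2 M" "h \<in> L2 M"
  shows "L2_norm M (\<lambda>x. g x + h x) \<le> L2_norm M g + L2_norm M h"
proof (rule power2_le_imp_le)
  have int: "integrable M (\<lambda>x. norm (g x) * norm (h x))"
    using integrable_norm[OF L2_mult_integrable[OF assms]] by (simp add: norm_mult)
  note I = L2_integrable[OF assms(1)] L2_integrable[OF assms(2)]
  have "(L2_norm M (\<lambda>x. g x + h x))\<^sup>2 \<le> (LINT x|M. (norm (g x))\<^sup>2 + (norm (h x))\<^sup>2 + 2 * (norm (g x) * norm (h x)))"
    unfolding L2_norm_square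
  proof (rule integral_mono)
    show "(norm (g x + h x))\<^sup>2 \<le> (norm (g x))\<^sup>2 + (norm (h x))\<^sup>2 + 2 * (norm (g x) * norm (h x))" for x
      using power_mono[OF norm_triangle_ineq[of "g x" "h x"], of 2] by (simp add: power2_sum)
  qed (use I int L2_integrable[OF L2_add[OF assms]] in auto)
  also have "\<dots> = (L2_norm M g)\<^sup>2 + (L2_norm M h)\<^sup>2 + 2 * (LINT x|M. norm (g x) * norm (h x))"
    using I int by (simp add: L2_norm_square)
  also have "\<dots> \<le> (L2_norm M g + L2_norm M h)\<^sup>2"
    using L2_norm_inner_le[OF assms] by (simp add: power2_sum)
  finally show "(L2_norm M (\<lambda>x. g x + h x))\<^sup>2 \<le> (L2_norm M g + L2_norm M h)\<^sup>2" .
qed simp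

lemma L2_norm_mult_left:
  fixes h :: "'a \<Rightarrow> 'b::{real_normed_div_algebra,banach,second_countable_topology}"
  shows "L2_norm M (\<lambda>x. c * h x) = norm c * L2_norm M h"
  by (simp add: L2_norm_def norm_mult power_mult_distrib real_sqrt_mult)

lemma L2_norm_minus_commute: "L2_norm M (\<lambda>x. g x - h x) = L2_norm M (\<lambda>x. h x - g x)"
  by (simp add: L2_norm_def norm_minus_commute)

lemma L2_norm_triangle_sub:
  fixes g h :: "'a \<Rightarrow> 'b::{real_normed_div_algebra,banach,second_countable_topology}"
  assumes "g \<in> L2 M" "h \<in> L2 M"
  shows "L2_norm M g \<le> L2_norm M h + L2_norm M (\<lambda>x. g x - h x)"
  using L2_norm_triangle[OF assms(2) L2_diff[OF assms]] by simp

lemma L2_norm_zero [simp]: "L2_norm M (\<lambda>x. 0) = 0"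
  by (simp add: L2_norm_def)

lemma L2_norm_sum_le:
  fixes h :: "'i \<Rightarrow> 'a \<Rightarrow> 'b::{real_normed_div_algebra,banach,second_countable_topology}"
  assumes "\<And>i. i \<in> S \<Longrightarrow> h i \<in> L2 M"
  shows "L2_norm M (\<lambda>x. \<Sum>i\<in>S. h i x) \<le> (\<Sum>i\<in>S. L2_norm M (h i))"
  using assms
proof (induction S rule: infinite_finite_induct)
  case (insert i S)
  then show ?case
    using L2_norm_triangle[of "h i" M "\<lambda>x. \<Sum>i\<in>S. h i x"] L2_sum[of S h M] by force
qed auto

lemma L2_norm_dominated_convergence:
  fixes h :: "'a \<Rightarrow> 'b::{real_normed_div_algebra,banach,second_countable_topology}"
  assumes "w \<in> L2 M" "\<And>n. s n \<in> borel_measurable M" "h \<in> borel_measurable M"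
    and lim: "\<And>x. x \<in> space M \<Longrightarrow> (\<lambda>n. s n x) \<longlonglongrightarrow> h x"
    and bound: "\<And>n x. x \<in> space M \<Longrightarrow> norm (h x - s n x) \<le> norm (w x)"
  shows "(\<lambda>n. L2_norm M (\<lambda>x. h x - s n x)) \<longlonglongrightarrow> 0"
proof -
  note [measurable] = assms(2,3)
  have "(\<lambda>n. LINT x|M. (norm (h x - s n x))\<^sup>2) \<longlonglongrightarrow> (LINT x|M. 0)"
  proof (rule integral_dominated_convergence[where w = "\<lambda>x. (norm (w x))\<^sup>2"])
    show "AE x in M. (\<lambda>n. (norm (h x - s n x))\<^sup>2) \<longlonglongrightarrow> 0"
    proof (rule AE_I2)
      fix x assume "x \<in> space M"
      from tendsto_power[OF tendsto_norm[OF tendsto_diff[OF tendsto_const[of "h x"] lim[OF this]]], of 2]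
      show "(\<lambda>n. (norm (h x - s n x))\<^sup>2) \<longlonglongrightarrow> 0" by simp
    qed
    show "AE x in M. norm ((norm (h x - s n x))\<^sup>2) \<le> (norm (w x))\<^sup>2" for n
      by (intro AE_I2) (auto intro!: power_mono bound)
  qed (use L2_integrable[OF assms(1)] in auto)
  from tendsto_real_sqrt[OF this] show ?thesis
    by (simp add: L2_norm_def)
qed

section \<open>An orthonormal basis of polynomials\<close>

interpretation unit_interval: prob_space unit_interval
  by standard (simp add: emeasure_restrict_space space_restrict_space)

lemma borel_measurable_unit_interval:
  "h \<in> borel_measurable borel \<Longrightarrow> h \<in> borel_measurable unit_interval"
  by (rule measurable_restrict_space1) simp

lemma space_unit_interval: "space unit_interval = {0..1}"
  by (simp add: space_restrict_space)

lemma poly_L2: "poly p \<in> L2 unit_interval" for p :: "real poly"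
proof -
  have "continuous_on {0..1} (poly p)"
    by (intro continuous_intros)
  then have "bounded (poly p ` {0..1})"
    by (intro compact_imp_bounded compact_continuous_image) auto
  then obtain C where "\<And>x. x \<in> {0..1} \<Longrightarrow> norm (poly p x) \<le> C"
    unfolding bounded_iff by blast
  moreover have "poly p \<in> borel_measurable borel"
    by (intro borel_measurable_continuous_onI continuous_intros)
  ultimately show ?thesis
    by (intro L2_bounded[where C = C] unit_interval.finite_measure_axioms borel_measurable_unit_interval)
       (auto simp: space_unit_interval)
qed

section \<open>Gram-Schmidt orthogonalisation of the monomials in L2([0,1])\<close>

definition poly_inner :: "real poly \<Rightarrow> real poly \<Rightarrow> real" where
  "poly_inner p q = (LINT x|unit_interval. poly p x * poly q x)"

lemma poly_inner_commute: "poly_inner p q = poly_inner q p"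
  by (simp add: poly_inner_def mult.commute)

lemma poly_inner_integrable: "integrable unit_interval (\<lambda>x. poly p x * poly q x)" for p q :: "real poly"
  by (intro L2_mult_integrable poly_L2)

lemma poly_inner_diff_left: "poly_inner (p - q) r = poly_inner p r - poly_inner q r"
  by (simp add: poly_inner_def left_diff_distrib Bochner_Integration.integral_diff poly_inner_integrable)

lemma poly_inner_smult_left: "poly_inner (smult c p) q = c * poly_inner p q"
  by (simp add: poly_inner_def mult.assoc)

lemma poly_inner_sum_left: "poly_inner (\<Sum>i\<in>S. p i) q = (\<Sum>i\<in>S. poly_inner (p i) q)"
  by (simp add: poly_inner_def poly_sum sum_distrib_right Bochner_Integration.integral_sum poly_inner_integrable)

text \<open>If the integral of the square vanished, the polynomial would be zero almost everywhere
  on [0,1]; but its roots are finitely many, hence a null set, and the interval has mass 1.\<close>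

lemma poly_inner_pos:
  assumes "p \<noteq> 0"
  shows "poly_inner p p > 0"
proof -
  have "poly_inner p p \<noteq> 0"
  proof
    assume "poly_inner p p = 0"
    then have "AE x in unit_interval. poly p x * poly p x = 0"
      unfolding poly_inner_def
      by (subst (asm) integral_nonneg_eq_0_iff_AE) (auto intro: poly_inner_integrable)
    moreover have "AE x in lborel. x \<notin> {x. poly p x = 0}"
      using poly_roots_finite[OF assms]
      by (intro AE_not_in null_setsI emeasure_lborel_countable countable_finite)
         (auto intro: borel_closed finite_imp_closed)
    then have "AE x in unit_interval. poly p x \<noteq> 0"
      by (subst AE_restrict_space_iff) auto
    ultimately have "AE x in unit_interval. False"
      by eventually_elim auto
    then show False
      by simp
  qed
  moreover have "poly_inner p p \<ge> 0"
    by (simp add: poly_inner_def)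
  ultimately show ?thesis
    by simp
qed

text \<open>Gram-Schmidt without normalisation, so that every member stays monic: these are the
  shifted Legendre polynomials up to scaling.\<close>

function legendre :: "nat \<Rightarrow> real poly" where
  "legendre n = monom 1 n - (\<Sum>i<n. smult (poly_inner (monom 1 n) (legendre i) /
      poly_inner (legendre i) (legendre i)) (legendre i))"
  by auto
termination
  by (relation "less_than") auto

declare legendre.simps [simp del]

lemma coeff_legendre_gt: "n < k \<Longrightarrow> coeff (legendre n) k = 0"
proof (induction n arbitrary: k rule: less_induct)
  case (less n)
  then have "coeff (legendre i) k = 0" if "i < n" for i
    using that by simp
  then show ?case
    using less.prems by (subst legendre.simps) (simp add: coeff_sum)
qed

text \<open>The subtracted terms have degree below \<open>n\<close>, so the leading coefficient of
  the monomial survives. This makes every \<open>legendre n\<close> nonzero and the change of basis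
  triangular.\<close>

lemma coeff_legendre_self: "coeff (legendre n) n = 1"
  by (subst legendre.simps) (simp add: coeff_sum coeff_legendre_gt)

lemma poly_inner_legendre_pos: "poly_inner (legendre n) (legendre n) > 0"
  using coeff_legendre_self[of n] by (intro poly_inner_pos) auto

text \<open>By the induction hypothesis only the summand \<open>i = j\<close> survives the inner
  product with \<open>legendre j\<close>, and its coefficient is chosen to cancel the contribution
  of the monomial.\<close>

lemma poly_inner_legendre_less: "j < n \<Longrightarrow> poly_inner (legendre n) (legendre j) = 0"
proof (induction n arbitrary: j rule: less_induct)
  case (less n)
  have orth: "poly_inner (legendre i) (legendre j) = 0" if "i < n" "i \<noteq> j" for i
    using that less.IH[of i j] less.IH[OF less.prems, of i]
      poly_inner_commute[of "legendre i" "legendre j"] by (metis nat_neq_iff)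
  have "poly_inner (legendre n) (legendre j) = poly_inner (monom 1 n) (legendre j)
      - (\<Sum>i<n. poly_inner (monom 1 n) (legendre i) / poly_inner (legendre i) (legendre i)
           * poly_inner (legendre i) (legendre j))"
    by (subst legendre.simps) (simp add: poly_inner_diff_left poly_inner_sum_left poly_inner_smult_left)
  also have "(\<Sum>i<n. poly_inner (monom 1 n) (legendre i) / poly_inner (legendre i) (legendre i)
           * poly_inner (legendre i) (legendre j)) =
      (\<Sum>i<n. if i = j then poly_inner (monom 1 n) (legendre j) else 0)"
    using poly_inner_legendre_pos[of j] by (intro sum.cong refl) (auto simp: orth)
  finally show ?case
    using less.prems by simp
qed

definition legendre_normalized :: "nat \<Rightarrow> real poly" where
  "legendre_normalized n = smult (1 / sqrt (poly_inner (legendre n) (legendre n))) (legendre n)"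

lemma poly_inner_legendre_normalized:
  "poly_inner (legendre_normalized i) (legendre_normalized j) = (if i = j then 1 else 0)"
proof -
  have "poly_inner (legendre i) (legendre j) = 0" if "i \<noteq> j"
    using that by (metis nat_neq_iff poly_inner_legendre_less poly_inner_commute)
  moreover have "poly_inner (legendre_normalized i) (legendre_normalized j) =
      poly_inner (legendre i) (legendre j) /
      (sqrt (poly_inner (legendre i) (legendre i)) * sqrt (poly_inner (legendre j) (legendre j)))"
    unfolding legendre_normalized_def
    by (subst poly_inner_smult_left, subst poly_inner_commute, subst poly_inner_smult_left)
       (simp add: poly_inner_commute)
  ultimately show ?thesis
    using poly_inner_legendre_pos[of i] by auto
qed

text \<open>Triangular elimination: subtracting the right multiple of the monic
  \<open>legendre n\<close> removes the coefficient of index \<open>n\<close>. Bounding indices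
  instead of the degree lets the induction start at the zero polynomial with an empty sum.\<close>

lemma poly_eq_sum_legendre_normalized:
  assumes "\<And>i. i \<ge> n \<Longrightarrow> coeff p i = 0"
  shows "\<exists>c. p = (\<Sum>i<n. smult (c i) (legendre_normalized i))"
  using assms
proof (induction n arbitrary: p)
  case 0
  then show ?case
    by (auto simp: poly_eq_iff)
next
  case (Suc n)
  define s where "s = sqrt (poly_inner (legendre n) (legendre n))"
  have s: "legendre n = smult s (legendre_normalized n)"
    using poly_inner_legendre_pos[of n] by (simp add: s_def legendre_normalized_def)
  have "coeff (p - smult (coeff p n) (legendre n)) i = 0" if "i \<ge> n" for i
    using that Suc.prems[of i] coeff_legendre_gt[of n i] coeff_legendre_self[of n]
    by (cases "i = n") auto
  from Suc.IH[OF this] obtain c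
    where c: "p - smult (coeff p n) (legendre n) = (\<Sum>i<n. smult (c i) (legendre_normalized i))"
    by blast
  \<comment> \<open>The factor \<open>s\<close> undoes the normalisation of the last vector.\<close>
  define c' where "c' = c(n := coeff p n * s)"
  have "(\<Sum>i<Suc n. smult (c' i) (legendre_normalized i)) =
      (\<Sum>i<n. smult (c i) (legendre_normalized i)) + smult (coeff p n) (legendre n)"
    by (simp add: s c'_def)
  then have "p = (\<Sum>i<Suc n. smult (c' i) (legendre_normalized i))"
    using c by (simp add: algebra_simps)
  then show ?case
    by blast
qed

subsection \<open>Density of the polynomials\<close>

text \<open>The closure of the polynomials in L2. It is a closed subspace, and it is enlarged from
  continuous functions to indicators and then to all of L2.\<close>

definition poly_approximable :: "(real \<Rightarrow> real) \<Rightarrow> bool" where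
  "poly_approximable h \<longleftrightarrow> h \<in> L2 unit_interval \<and>
     (\<forall>\<epsilon>>0. \<exists>p. L2_norm unit_interval (\<lambda>x. h x - poly p x) < \<epsilon>)"

lemma poly_approximable_imp_L2: "poly_approximable h \<Longrightarrow> h \<in> L2 unit_interval"
  by (simp add: poly_approximable_def)

lemma poly_approximable_add:
  assumes "poly_approximable g" "poly_approximable h"
  shows "poly_approximable (\<lambda>x. g x + h x)"
  unfolding poly_approximable_def
proof (intro conjI allI impI)
  fix \<epsilon> :: real assume "\<epsilon> > 0"
  then obtain p q where pq: "L2_norm unit_interval (\<lambda>x. g x - poly p x) < \<epsilon> / 2"
      "L2_norm unit_interval (\<lambda>x. h x - poly q x) < \<epsilon> / 2"
    using assms unfolding poly_approximable_def by (meson half_gt_zero)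
  have "L2_norm unit_interval (\<lambda>x. (g x - poly p x) + (h x - poly q x)) \<le>
      L2_norm unit_interval (\<lambda>x. g x - poly p x) + L2_norm unit_interval (\<lambda>x. h x - poly q x)"
    using assms by (intro L2_norm_triangle L2_diff poly_L2) (auto simp: poly_approximable_def)
  also have "(\<lambda>x. (g x - poly p x) + (h x - poly q x)) = (\<lambda>x. g x + h x - poly (p + q) x)"
    by (auto simp: algebra_simps)
  finally show "\<exists>p. L2_norm unit_interval (\<lambda>x. g x + h x - poly p x) < \<epsilon>"
    using pq by (intro exI[of _ "p + q"]) linarith
qed (use assms in \<open>auto intro: L2_add simp: poly_approximable_def\<close>)

lemma poly_approximable_scale:
  assumes "poly_approximable h"
  shows "poly_approximable (\<lambda>x. c * h x)"
  unfolding poly_approximable_def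
proof (intro conjI allI impI)
  fix \<epsilon> :: real assume "\<epsilon> > 0"
  \<comment> \<open>Adding 1 to \<open>\<bar>c\<bar>\<close> avoids a division by zero when
    \<open>c = 0\<close>.\<close>
  then obtain p where p: "L2_norm unit_interval (\<lambda>x. h x - poly p x) < \<epsilon> / (\<bar>c\<bar> + 1)"
    using assms unfolding poly_approximable_def
    by (meson abs_ge_zero add_nonneg_pos divide_pos_pos zero_less_one)
  have "L2_norm unit_interval (\<lambda>x. c * h x - poly (smult c p) x) =
      \<bar>c\<bar> * L2_norm unit_interval (\<lambda>x. h x - poly p x)"
    using L2_norm_mult_left[of unit_interval c "\<lambda>x. h x - poly p x"] by (simp add: right_diff_distrib)
  also have "\<dots> \<le> (\<bar>c\<bar> + 1) * L2_norm unit_interval (\<lambda>x. h x - poly p x)"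
    by (intro mult_right_mono) auto
  also have "\<dots> < \<epsilon>"
    using p by (simp add: pos_less_divide_eq mult.commute)
  finally show "\<exists>p. L2_norm unit_interval (\<lambda>x. c * h x - poly p x) < \<epsilon>"
    by blast
qed (use assms in \<open>auto intro: L2_mult_left simp: poly_approximable_def\<close>)

lemma poly_approximable_zero: "poly_approximable (\<lambda>x. 0)"
  unfolding poly_approximable_def
  by (auto intro!: exI[of _ 0])

lemma poly_approximable_sum:
  assumes "\<And>i. i \<in> S \<Longrightarrow> poly_approximable (h i)"
  shows "poly_approximable (\<lambda>x. \<Sum>i\<in>S. h i x)"
  using assms
  by (induction S rule: infinite_finite_induct) (auto intro: poly_approximable_add poly_approximable_zero)

lemma poly_approximable_limit:
  assumes "\<And>n. poly_approximable (s n)" "h \<in> L2 unit_interval"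
    and "(\<lambda>n. L2_norm unit_interval (\<lambda>x. h x - s n x)) \<longlonglongrightarrow> 0"
  shows "poly_approximable h"
  unfolding poly_approximable_def
proof (intro conjI allI impI)
  fix \<epsilon> :: real assume "\<epsilon> > 0"
  then have "\<forall>\<^sub>F n in sequentially. L2_norm unit_interval (\<lambda>x. h x - s n x) < \<epsilon> / 2"
    using assms(3) by (intro order_tendstoD) auto
  then obtain n where n: "L2_norm unit_interval (\<lambda>x. h x - s n x) < \<epsilon> / 2"
    by (auto dest: eventually_happens)
  from assms(1)[of n] \<open>\<epsilon> > 0\<close> obtain p where p: "L2_norm unit_interval (\<lambda>x. s n x - poly p x) < \<epsilon> / 2"
    unfolding poly_approximable_def by (meson half_gt_zero)
  have "L2_norm unit_interval (\<lambda>x. (h x - s n x) + (s n x - poly p x)) \<le>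
      L2_norm unit_interval (\<lambda>x. h x - s n x) + L2_norm unit_interval (\<lambda>x. s n x - poly p x)"
    using assms by (intro L2_norm_triangle L2_diff poly_L2) (auto simp: poly_approximable_def)
  with n p show "\<exists>p. L2_norm unit_interval (\<lambda>x. h x - poly p x) < \<epsilon>"
    by (intro exI[of _ p]) simp
qed (use assms in auto)

lemma poly_approximable_dominated_limit:
  assumes "\<And>n. poly_approximable (s n)" "h \<in> L2 unit_interval" "w \<in> L2 unit_interval"
    and "\<And>x. x \<in> {0..1} \<Longrightarrow> (\<lambda>n. s n x) \<longlonglongrightarrow> h x"
    and "\<And>n x. x \<in> {0..1} \<Longrightarrow> \<bar>h x - s n x\<bar> \<le> \<bar>w x\<bar>"
  shows "poly_approximable h"
proof (rule poly_approximable_limit[OF assms(1,2)])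
  show "(\<lambda>n. L2_norm unit_interval (\<lambda>x. h x - s n x)) \<longlonglongrightarrow> 0"
    by (rule L2_norm_dominated_convergence[where w = w])
       (use assms in \<open>auto simp: space_unit_interval intro!: L2_measurable poly_approximable_imp_L2\<close>)
qed

text \<open>Bernstein polynomials converge uniformly on [0,1], and since the interval has mass 1 a
  uniform error bounds the L2 error.\<close>

lemma poly_approximable_continuous:
  assumes "continuous_on UNIV h"
  shows "poly_approximable h"
proof -
  have h: "h \<in> borel_measurable borel"
    using assms by (rule borel_measurable_continuous_onI)
  have cont: "continuous_on {0..1} h"
    using assms by (rule continuous_on_subset) simp
  \<comment> \<open>The Bernstein sum as a formal polynomial; \<open>[:1, -1:]\<close> stands for 1
    - x.\<close>
  define b :: "nat \<Rightarrow> real poly" where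
    "b n = (\<Sum>k\<le>n. smult (h (k / n) * (n choose k)) (monom 1 k * [:1, -1:] ^ (n - k)))" for n
  have b: "poly (b n) x = (\<Sum>k\<le>n. h (k / n) * Bernstein n k x)" for n x
    by (simp add: b_def poly_sum Bernstein_def poly_monom mult_ac)
  have "bounded (h ` {0..1})"
    using cont by (intro compact_imp_bounded compact_continuous_image) auto
  then obtain C where "\<And>x. x \<in> {0..1} \<Longrightarrow> norm (h x) \<le> C"
    unfolding bounded_iff by blast
  then have hL2: "h \<in> L2 unit_interval"
    using h by (intro L2_bounded[where C = C] unit_interval.finite_measure_axioms borel_measurable_unit_interval)
       (auto simp: space_unit_interval)
  have "\<exists>p. L2_norm unit_interval (\<lambda>x. h x - poly p x) < \<epsilon>" if \<epsilon>: "\<epsilon> > 0" for \<epsilon>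
  proof -
    \<comment> \<open>Half of \<open>\<epsilon>\<close> leaves room, because integrating the
      pointwise bound gives only a non-strict inequality.\<close>
    obtain N where N: "\<forall>n x. N \<le> n \<and> x \<in> {0..1} \<longrightarrow> \<bar>h x - (\<Sum>k\<le>n. h (k / n) * Bernstein n k x)\<bar> < \<epsilon> / 2"
      using Bernstein_Weierstrass[OF cont half_gt_zero[OF \<epsilon>]] ..
    have "(L2_norm unit_interval (\<lambda>x. h x - poly (b N) x))\<^sup>2 \<le> (LINT x|unit_interval. (\<epsilon> / 2)\<^sup>2)"
      unfolding L2_norm_square
    proof (rule integral_mono)
      show "integrable unit_interval (\<lambda>x. (norm (h x - poly (b N) x))\<^sup>2)"
        by (intro L2_integrable L2_diff hL2 poly_L2)
      fix x assume "x \<in> space unit_interval"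
      then have "x \<in> {0..1}"
        by (simp add: space_unit_interval)
      then have "norm (h x - poly (b N) x) \<le> \<epsilon> / 2"
        unfolding b real_norm_def using N by (intro less_imp_le) blast
      then show "(norm (h x - poly (b N) x))\<^sup>2 \<le> (\<epsilon> / 2)\<^sup>2"
        by (intro power_mono) simp_all
    qed simp
    also have "\<dots> = (\<epsilon> / 2)\<^sup>2"
      unfolding lebesgue_integral_const unit_interval.prob_space by simp
    finally have "(L2_norm unit_interval (\<lambda>x. h x - poly (b N) x))\<^sup>2 \<le> (\<epsilon> / 2)\<^sup>2" .
    then have "L2_norm unit_interval (\<lambda>x. h x - poly (b N) x) \<le> \<epsilon> / 2"
      by (rule power2_le_imp_le) (use \<epsilon> in simp)
    also have "\<dots> < \<epsilon>"
      using \<epsilon> by simp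
    finally show ?thesis ..
  qed
  with hL2 show ?thesis
    by (simp add: poly_approximable_def)
qed

lemma L2_indicator: "A \<in> sets borel \<Longrightarrow> (indicator A :: real \<Rightarrow> real) \<in> L2 unit_interval"
  by (intro L2_bounded[where C = 1] unit_interval.finite_measure_axioms borel_measurable_unit_interval)
     (auto simp: indicator_def)

text \<open>The approximants are continuous ramps: 1 up to \<open>a\<close>, then falling with slope
  -n, so that for positive \<open>n\<close> they are 0 from a + 1/n on.\<close>

lemma poly_approximable_indicator_atMost: "poly_approximable (indicator {..a})"
proof (rule poly_approximable_dominated_limit)
  show "poly_approximable (\<lambda>x. max 0 (min 1 (1 - real n * (x - a))))" for n
    by (intro poly_approximable_continuous continuous_intros)
  show "(\<lambda>x. 1) \<in> L2 unit_interval"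
    by (simp add: L2_def)
  show "\<bar>indicator {..a} x - max 0 (min 1 (1 - real n * (x - a)))\<bar> \<le> \<bar>1\<bar>" for n x
    by (auto simp: indicator_def)
  show "(\<lambda>n. max 0 (min 1 (1 - real n * (x - a)))) \<longlonglongrightarrow> indicator {..a} x" for x
  proof (cases "x \<le> a")
    case True
    then have "real n * (x - a) \<le> 0" for n
      by (simp add: mult_nonneg_nonpos)
    then have "max 0 (min 1 (1 - real n * (x - a))) = 1" for n
      by (smt (verit))
    with True show ?thesis
      by simp
  next
    case False
    have "\<forall>\<^sub>F n in sequentially. max 0 (min 1 (1 - real n * (x - a))) = 0"
      \<comment> \<open>Beyond this index 1/n is at most x - a, so \<open>x\<close> lies past the
        end of the ramp.\<close>
      using eventually_ge_at_top[of "nat \<lceil>1 / (x - a)\<rceil>"]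
    proof eventually_elim
      case (elim n)
      then have "1 / (x - a) \<le> real n"
        by linarith
      then have "1 \<le> real n * (x - a)"
        using False by (simp add: pos_divide_le_eq)
      then show ?case
        by simp
    qed
    then show ?thesis
      using False by (simp add: tendsto_eventually)
  qed
qed (auto intro: L2_indicator)

text \<open>Induction over the intersection-stable generator of closed half-lines. Complements use
  linearity; for disjoint unions the partial sums are indicators of finite unions, so the error is
  dominated by 1.\<close>

lemma poly_approximable_indicator:
  assumes "A \<in> sets borel"
  shows "poly_approximable (indicator A)"
proof -
  have G: "sets borel = sigma_sets UNIV (range (\<lambda>a::real. {..a}))"
    by (subst borel_eq_atMost) simp
  have "Int_stable (range (\<lambda>a::real. {..a}))"
    by (auto simp: Int_stable_def)
  moreover have "range (\<lambda>a::real. {..a}) \<subseteq> Pow UNIV"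
    by simp
  moreover have "A \<in> sigma_sets UNIV (range (\<lambda>a. {..a}))"
    using assms G by simp
  ultimately show ?thesis
  proof (induction rule: sigma_sets_induct_disjoint)
    case (basic A)
    then show ?case
      by (auto intro: poly_approximable_indicator_atMost)
  next
    case empty
    then show ?case
      using poly_approximable_zero by (simp add: indicator_def)
  next
    case (compl A)
    have "poly_approximable (\<lambda>x. 1 + (- 1) * indicator A x)"
      by (intro poly_approximable_add poly_approximable_scale compl poly_approximable_continuous continuous_intros)
    also have "(\<lambda>x. 1 + (- 1) * indicator A x) = (indicator (UNIV - A) :: real \<Rightarrow> real)"
      by (auto simp: indicator_def)
    finally show ?case .
  next
    case (union A)
    show ?case
    proof (rule poly_approximable_dominated_limit)
      show "poly_approximable (\<lambda>x. \<Sum>i<n. indicator (A i) x)" for n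
        by (intro poly_approximable_sum union)
      show "(indicator (\<Union>i. A i) :: real \<Rightarrow> real) \<in> L2 unit_interval"
      proof (rule L2_indicator)
        show "(\<Union>i. A i) \<in> sets borel"
          using union(2) unfolding G[symmetric] by (intro sets.countable_UN)
      qed
      show "(\<lambda>x. 1) \<in> L2 unit_interval"
        by (simp add: L2_def)
      have eq: "(\<Sum>i<n. indicator (A i) x) = (indicator (\<Union>i<n. A i) x :: real)" for n x
        using union(1) by (intro indicator_UN_disjoint[symmetric]) (auto simp: disjoint_family_on_def)
      show "\<bar>indicator (\<Union>i. A i) x - (\<Sum>i<n. indicator (A i) x)\<bar> \<le> \<bar>1 :: real\<bar>" for n x
        unfolding eq by (auto simp: indicator_def)
      show "(\<lambda>n. \<Sum>i<n. indicator (A i) x) \<longlonglongrightarrow> (indicator (\<Union>i. A i) x :: real)" for x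
        unfolding eq by (rule LIMSEQ_indicator_UN)
    qed
  qed
qed

text \<open>A measurable function is the pointwise limit of simple functions of modulus at most
  twice its own, and on [0,1] simple functions are finite combinations of indicators of Borel
  sets.\<close>

lemma poly_approximable_L2:
  assumes "h \<in> L2 unit_interval"
  shows "poly_approximable h"
proof -
  from borel_measurable_implies_sequence_metric[OF L2_measurable[OF assms], of 0]
  obtain s where s: "\<And>i. simple_function unit_interval (s i)"
    and lim: "\<And>x. x \<in> {0..1} \<Longrightarrow> (\<lambda>i. s i x) \<longlonglongrightarrow> h x"
    and bound: "\<And>i x. x \<in> {0..1} \<Longrightarrow> \<bar>s i x\<bar> \<le> 2 * \<bar>h x\<bar>"
    unfolding space_unit_interval real_norm_def dist_real_def diff_0_right by blast
  have approx: "poly_approximable (\<lambda>x. \<Sum>y\<in>s i ` {0..1}. y * indicator (s i -` {y} \<inter> {0..1}) x)" for i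
  proof (intro poly_approximable_sum poly_approximable_scale poly_approximable_indicator)
    fix y
    have "s i -` {y} \<inter> space unit_interval \<in> sets unit_interval"
      using s[of i] by (rule simple_functionD)
    then show "s i -` {y} \<inter> {0..1} \<in> sets borel"
      by (auto simp: space_unit_interval sets_restrict_space)
  qed
  have repr: "(\<Sum>y\<in>s i ` {0..1}. y * indicator (s i -` {y} \<inter> {0..1}) x) = s i x" if "x \<in> {0..1}" for i x
  proof -
    have "finite (s i ` {0..1})"
      using simple_functionD(1)[OF s[of i]] by (simp add: space_unit_interval)
    moreover have "(\<Sum>y\<in>s i ` {0..1}. y * indicator (s i -` {y} \<inter> {0..1}) x) =
        (\<Sum>y\<in>s i ` {0..1}. if y = s i x then y else 0)"
      using that by (intro sum.cong) (auto simp: indicator_def)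
    ultimately show ?thesis
      using that by simp
  qed
  show ?thesis
  proof (rule poly_approximable_dominated_limit[OF approx assms])
    \<comment> \<open>The dominating function is \<open>3 * h\<close>: one for \<open>h\<close>
      itself and two for the bound on \<open>s i\<close>.\<close>
    show "(\<lambda>x. 3 * h x) \<in> L2 unit_interval"
      by (intro L2_mult_left assms)
    show "(\<lambda>i. \<Sum>y\<in>s i ` {0..1}. y * indicator (s i -` {y} \<inter> {0..1}) x) \<longlonglongrightarrow> h x" if "x \<in> {0..1}" for x
      using lim[OF that] by (simp only: repr[OF that])
    show "\<bar>h x - (\<Sum>y\<in>s i ` {0..1}. y * indicator (s i -` {y} \<inter> {0..1}) x)\<bar> \<le> \<bar>3 * h x\<bar>"
      if "x \<in> {0..1}" for i x
      unfolding repr[OF that] using bound[OF that, of i] by linarith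
  qed
qed

subsection \<open>Existence of an orthonormal basis and Parseval's identity\<close>

text \<open>Pythagoras with a completed square in each coefficient. It shows at once that the
  Fourier coefficients give the best approximation from the span and what error remains.\<close>

lemma L2_norm_diff_orthonormal_sum:
  fixes e :: "nat \<Rightarrow> 'a \<Rightarrow> real"
  assumes e: "\<And>i. e i \<in> L2 M" and orth: "\<And>i j. (LINT x|M. e i x * e j x) = (if i = j then 1 else 0)"
    and h: "h \<in> L2 M"
  shows "(L2_norm M (\<lambda>x. h x - (\<Sum>i<n. c i * e i x)))\<^sup>2 =
    (L2_norm M h)\<^sup>2 - (\<Sum>i<n. (LINT x|M. h x * e i x)\<^sup>2) + (\<Sum>i<n. (c i - (LINT x|M. h x * e i x))\<^sup>2)"
proof (induction n)
  case (Suc n)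
  define g where "g x = h x - (\<Sum>i<n. c i * e i x)" for x
  have g: "g \<in> L2 M"
    unfolding g_def by (intro L2_diff h L2_sum L2_mult_left e)
  note int = L2_mult_integrable[OF h e] L2_mult_integrable[OF g e] L2_mult_integrable[OF e e]
    L2_mult_integrable[OF g g]
  \<comment> \<open>\<open>e n\<close> is orthogonal to the terms already subtracted, so
    \<open>g\<close> and \<open>h\<close> have the same coefficient along it.\<close>
  have "(LINT x|M. g x * e n x) = (LINT x|M. h x * e n x - (\<Sum>i<n. c i * (e i x * e n x)))"
    by (simp add: g_def left_diff_distrib sum_distrib_right mult.assoc)
  also have "\<dots> = (LINT x|M. h x * e n x) - (\<Sum>i<n. c i * (LINT x|M. e i x * e n x))"
    using int by (subst Bochner_Integration.integral_diff)
      (auto intro!: Bochner_Integration.integrable_sum simp: Bochner_Integration.integral_sum)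
  also have "\<dots> = (LINT x|M. h x * e n x)"
    by (simp add: orth)
  finally have ge: "(LINT x|M. g x * e n x) = (LINT x|M. h x * e n x)" .
  have "(L2_norm M (\<lambda>x. h x - (\<Sum>i<Suc n. c i * e i x)))\<^sup>2 =
      (LINT x|M. g x * g x - 2 * c n * (g x * e n x) + (c n)\<^sup>2 * (e n x * e n x))"
    unfolding L2_norm_square
    by (intro Bochner_Integration.integral_cong) (auto simp: g_def power2_eq_square algebra_simps)
  also have "\<dots> = (LINT x|M. g x * g x) - 2 * c n * (LINT x|M. g x * e n x) + (c n)\<^sup>2 * (LINT x|M. e n x * e n x)"
    using int by simp
  also have "\<dots> = (L2_norm M g)\<^sup>2 - 2 * c n * (LINT x|M. h x * e n x) + (c n)\<^sup>2"
    by (simp add: ge orth L2_norm_square[of M g]) (simp add: power2_eq_square)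
  also have "(L2_norm M g)\<^sup>2 = (L2_norm M h)\<^sup>2 - (\<Sum>i<n. (LINT x|M. h x * e i x)\<^sup>2) + (\<Sum>i<n. (c i - (LINT x|M. h x * e i x))\<^sup>2)"
    unfolding g_def by (rule Suc.IH)
  finally show ?case
    by (simp add: power2_diff algebra_simps)
qed simp

text \<open>As soon as \<open>n\<close> exceeds the degree of an approximating polynomial, that
  polynomial lies in the span of the first \<open>n\<close> vectors, and the Fourier sum is at least
  as close to \<open>h\<close>.\<close>

lemma orthonormal_basis_legendre: "orthonormal_basis (\<lambda>n. poly (legendre_normalized n))"
  unfolding orthonormal_basis_def
proof (intro conjI allI ballI)
  let ?e = "\<lambda>n. poly (legendre_normalized n)"
  show "?e i \<in> L2 unit_interval" for i
    by (rule poly_L2)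
  show orth: "(LINT x|unit_interval. ?e i x * ?e j x) = (if i = j then 1 else 0)" for i j
    using poly_inner_legendre_normalized by (simp add: poly_inner_def)
  fix h :: "real \<Rightarrow> real" assume h: "h \<in> L2 unit_interval"
  show "(\<lambda>n. L2_norm unit_interval
           (\<lambda>x. h x - (\<Sum>i<n. (LINT y|unit_interval. h y * ?e i y) * ?e i x))) \<longlonglongrightarrow> 0"
  proof (rule LIMSEQ_I)
    fix \<epsilon> :: real assume "\<epsilon> > 0"
    then obtain p where p: "L2_norm unit_interval (\<lambda>x. h x - poly p x) < \<epsilon>"
      using poly_approximable_L2[OF h] by (auto simp: poly_approximable_def)
    have "L2_norm unit_interval (\<lambda>x. h x - (\<Sum>i<n. (LINT y|unit_interval. h y * ?e i y) * ?e i x)) < \<epsilon>"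
      if n: "n > degree p" for n
    proof -
      obtain c where c: "p = (\<Sum>i<n. smult (c i) (legendre_normalized i))"
        using poly_eq_sum_legendre_normalized[of n p] n by (auto simp: coeff_eq_0)
      have "(L2_norm unit_interval (\<lambda>x. h x - (\<Sum>i<n. (LINT y|unit_interval. h y * ?e i y) * ?e i x)))\<^sup>2
          \<le> (L2_norm unit_interval (\<lambda>x. h x - (\<Sum>i<n. c i * ?e i x)))\<^sup>2"
        by (subst (1 2) L2_norm_diff_orthonormal_sum[OF poly_L2 orth h]) (simp add: sum_nonneg)
      then have "L2_norm unit_interval (\<lambda>x. h x - (\<Sum>i<n. (LINT y|unit_interval. h y * ?e i y) * ?e i x))
          \<le> L2_norm unit_interval (\<lambda>x. h x - (\<Sum>i<n. c i * ?e i x))"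
        by (rule power2_le_imp_le) simp
      also have "(\<lambda>x. h x - (\<Sum>i<n. c i * ?e i x)) = (\<lambda>x. h x - poly p x)"
        by (subst c) (simp add: poly_sum)
      finally show ?thesis
        using p by simp
    qed
    then show "\<exists>no. \<forall>n\<ge>no. norm (L2_norm unit_interval
        (\<lambda>x. h x - (\<Sum>i<n. (LINT y|unit_interval. h y * ?e i y) * ?e i x)) - 0) < \<epsilon>"
      by (intro exI[of _ "Suc (degree p)"]) auto
  qed
qed

text \<open>Existence of one orthonormal basis turns the \<open>SOME\<close> in \<open>basis\<close>
  into a genuine choice; from here on nothing else about the choice enters.\<close>

lemma orthonormal_basis_basis: "orthonormal_basis basis"
  unfolding basis_def by (rule someI[of orthonormal_basis, OF orthonormal_basis_legendre])

lemma basis_L2: "basis i \<in> L2 unit_interval"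
  using orthonormal_basis_basis by (simp add: orthonormal_basis_def)

lemma basis_measurable [measurable]: "basis i \<in> borel_measurable unit_interval"
  by (rule L2_measurable[OF basis_L2])

text \<open>The squared error of the Fourier sum is the squared norm minus the partial sum of
  squared coefficients, and completeness sends it to 0.\<close>

lemma parseval_real:
  fixes h :: "real \<Rightarrow> real"
  assumes h: "h \<in> L2 unit_interval"
  shows "(\<lambda>i. (LINT x|unit_interval. h x * basis i x)\<^sup>2) sums (L2_norm unit_interval h)\<^sup>2"
proof -
  let ?c = "\<lambda>i. LINT x|unit_interval. h x * basis i x"
  have orth: "(LINT x|unit_interval. basis i x * basis j x) = (if i = j then 1 else 0)" for i j
    using orthonormal_basis_basis by (simp add: orthonormal_basis_def)
  have "(\<lambda>n. (L2_norm unit_interval (\<lambda>x. h x - (\<Sum>i<n. ?c i * basis i x)))\<^sup>2) \<longlonglongrightarrow> 0\<^sup>2"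
    using orthonormal_basis_basis h by (intro tendsto_power) (simp add: orthonormal_basis_def)
  then have "(\<lambda>n. (L2_norm unit_interval h)\<^sup>2 - (\<Sum>i<n. (?c i)\<^sup>2)) \<longlonglongrightarrow> 0"
    by (simp add: L2_norm_diff_orthonormal_sum[OF basis_L2 orth h])
  from tendsto_diff[OF tendsto_const[of "(L2_norm unit_interval h)\<^sup>2"] this] show ?thesis
    by (simp add: sums_def)
qed

lemma L2_of_real: "h \<in> L2 M \<Longrightarrow> (\<lambda>x. complex_of_real (h x)) \<in> L2 M"
  by (auto simp: L2_def)

text \<open>The basis is real, so coefficients and norm both split into real and imaginary
  parts.\<close>

lemma parseval_complex:
  fixes h :: "real \<Rightarrow> complex"
  assumes h: "h \<in> L2 unit_interval"
  shows "(\<lambda>i. (cmod (LINT x|unit_interval. h x * complex_of_real (basis i x)))\<^sup>2) sums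
    (L2_norm unit_interval h)\<^sup>2"
proof -
  note [measurable] = L2_measurable[OF h]
  have le: "(norm (Re z))\<^sup>2 \<le> (cmod z)\<^sup>2" "(norm (Im z))\<^sup>2 \<le> (cmod z)\<^sup>2" for z
    by (auto simp: cmod_power2)
  have re: "(\<lambda>x. Re (h x)) \<in> L2 unit_interval" and im: "(\<lambda>x. Im (h x)) \<in> L2 unit_interval"
    using L2_integrable[OF h] le unfolding L2_def
    by (auto intro!: Bochner_Integration.integrable_bound[OF L2_integrable[OF h]])
  have int: "integrable unit_interval (\<lambda>x. h x * complex_of_real (basis i x))" for i
    by (intro L2_mult_integrable h L2_of_real basis_L2)
  have "(cmod (LINT x|unit_interval. h x * complex_of_real (basis i x)))\<^sup>2 =
     (LINT x|unit_interval. Re (h x) * basis i x)\<^sup>2 + (LINT x|unit_interval. Im (h x) * basis i x)\<^sup>2" for i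
    by (simp add: cmod_power2 int flip: integral_Re integral_Im)
  moreover have "(L2_norm unit_interval h)\<^sup>2 =
      (L2_norm unit_interval (\<lambda>x. Re (h x)))\<^sup>2 + (L2_norm unit_interval (\<lambda>x. Im (h x)))\<^sup>2"
    using L2_integrable[OF re] L2_integrable[OF im] by (simp add: L2_norm_square cmod_power2)
  ultimately show ?thesis
    using sums_add[OF parseval_real[OF re] parseval_real[OF im]] by simp
qed

section \<open>Square-integrable kernels\<close>

lemma (in sigma_finite_measure) L2I_pair:
  assumes "k \<in> borel_measurable (N \<Otimes>\<^sub>M M)"
    and "(\<integral>\<^sup>+x. \<integral>\<^sup>+y. ennreal ((norm (k (x, y)))\<^sup>2) \<partial>M \<partial>N) < \<infinity>"
  shows "k \<in> L2 (N \<Otimes>\<^sub>M M)"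
proof (rule L2I_nn_integral[OF assms(1)])
  have "(\<integral>\<^sup>+z. ennreal ((norm (k z))\<^sup>2) \<partial>(N \<Otimes>\<^sub>M M)) = (\<integral>\<^sup>+x. \<integral>\<^sup>+y. ennreal ((norm (k (x, y)))\<^sup>2) \<partial>M \<partial>N)"
    using assms(1) by (intro nn_integral_fst[symmetric]) measurable
  then show "(\<integral>\<^sup>+z. ennreal ((norm (k z))\<^sup>2) \<partial>(N \<Otimes>\<^sub>M M)) < \<infinity>"
    using assms(2) by simp
qed

context pair_sigma_finite
begin

lemma AE_L2_section:
  assumes k: "k \<in> L2 (M1 \<Otimes>\<^sub>M M2)"
  shows "AE x in M1. (\<lambda>y. k (x, y)) \<in> L2 M2"
  using AE_integrable_fst'[OF L2_integrable[OF k]] AE_space[of M1]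
proof eventually_elim
  case (elim x)
  then show ?case
    using measurable_compose_Pair1[OF elim(2) L2_measurable[OF k]] by (simp add: L2_def)
qed

lemma L2_swap:
  assumes k: "k \<in> L2 (M1 \<Otimes>\<^sub>M M2)"
  shows "(\<lambda>(y, x). k (x, y)) \<in> L2 (M2 \<Otimes>\<^sub>M M1)"
  using L2_measurable[OF k] integrable_product_swap[OF L2_integrable[OF k]]
  unfolding L2_def by (auto simp: case_prod_beta' intro: measurable_pair_swap)

text \<open>Cauchy-Schwarz in \<open>y\<close> for almost every \<open>x\<close>, integrated over
  \<open>x\<close>. Besides integral operators this covers averages over the frequency, with a
  constant \<open>h\<close>.\<close>

lemma
  fixes k :: "'a \<times> 'b \<Rightarrow> 'c::{real_normed_field,banach,second_countable_topology}"
  assumes k: "k \<in> L2 (M1 \<Otimes>\<^sub>M M2)" and h: "h \<in> L2 M2"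
  shows L2_kernel_integral: "(\<lambda>x. LINT y|M2. k (x, y) * h y) \<in> L2 M1"
    and L2_norm_kernel_integral_le:
      "L2_norm M1 (\<lambda>x. LINT y|M2. k (x, y) * h y) \<le> L2_norm (M1 \<Otimes>\<^sub>M M2) k * L2_norm M2 h"
proof -
  note [measurable] = L2_measurable[OF k] L2_measurable[OF h]
  let ?K = "\<lambda>x. LINT y|M2. k (x, y) * h y"
  let ?B = "\<lambda>x. (LINT y|M2. (norm (k (x, y)))\<^sup>2) * (L2_norm M2 h)\<^sup>2"
  have meas: "?K \<in> borel_measurable M1"
    by measurable
  have int: "integrable M1 ?B"
    using integrable_fst'[OF L2_integrable[OF k]] by simp
  have le: "AE x in M1. (norm (?K x))\<^sup>2 \<le> ?B x"
    using AE_L2_section[OF k]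
  proof eventually_elim
    case (elim x)
    have "norm (?K x) \<le> (LINT y|M2. norm (k (x, y)) * norm (h y))"
      using integral_norm_bound[of M2 "\<lambda>y. k (x, y) * h y"] by (simp add: norm_mult)
    also have "\<dots> \<le> L2_norm M2 (\<lambda>y. k (x, y)) * L2_norm M2 h"
      by (rule L2_norm_inner_le[OF elim h])
    finally have "(norm (?K x))\<^sup>2 \<le> (L2_norm M2 (\<lambda>y. k (x, y)) * L2_norm M2 h)\<^sup>2"
      by (intro power_mono) auto
    then show ?case
      by (simp only: power_mult_distrib L2_norm_square[of M2 "\<lambda>y. k (x, y)"])
  qed
  have intK: "integrable M1 (\<lambda>x. (norm (?K x))\<^sup>2)"
    by (rule Bochner_Integration.integrable_bound[OF int]) (use le in auto)
  with meas show "?K \<in> L2 M1"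
    by (simp add: L2_def)
  have "(L2_norm M1 ?K)\<^sup>2 \<le> (LINT x|M1. ?B x)"
    unfolding L2_norm_square[of M1] by (rule integral_mono_AE[OF intK int le])
  also have "\<dots> = (L2_norm (M1 \<Otimes>\<^sub>M M2) k * L2_norm M2 h)\<^sup>2"
    using integral_fst'[OF L2_integrable[OF k]]
    by (simp add: power_mult_distrib L2_norm_square[of "M1 \<Otimes>\<^sub>M M2"])
  finally show "L2_norm M1 ?K \<le> L2_norm (M1 \<Otimes>\<^sub>M M2) k * L2_norm M2 h"
    by (rule power2_le_imp_le) simp
qed

end

interpretation unit_square: pair_prob_space unit_interval unit_interval
  by standard

section \<open>Integral operators are Hilbert-Schmidt\<close>

lemma L2_norm_of_real: "L2_norm M (\<lambda>x. complex_of_real (h x)) = L2_norm M h"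
  by (simp add: L2_norm_def)

lemma
  assumes "k \<in> L2 unit_square" "h \<in> L2 unit_interval"
  shows integral_operator_L2: "integral_operator k h \<in> L2 unit_interval"
    and L2_norm_integral_operator_le:
      "L2_norm unit_interval (integral_operator k h) \<le> L2_norm unit_square k * L2_norm unit_interval h"
  using unit_square.L2_kernel_integral[OF assms(1) L2_of_real[OF assms(2)]]
    unit_square.L2_norm_kernel_integral_le[OF assms(1) L2_of_real[OF assms(2)]]
  by (simp_all add: integral_operator_def[abs_def] L2_norm_of_real)

text \<open>At an exceptional \<open>\<tau>\<close> the integral may default to 0 and additivity may
  fail, so identities between kernel operators hold only almost everywhere.\<close>

lemma AE_integrable_integral_operator:
  assumes "k \<in> L2 unit_square" "h \<in> L2 unit_interval"
  shows "AE \<tau> in unit_interval. integrable unit_interval (\<lambda>\<sigma>. k (\<tau>, \<sigma>) * complex_of_real (h \<sigma>))"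
  using unit_square.AE_L2_section[OF assms(1)]
  by eventually_elim (intro L2_mult_integrable L2_of_real assms(2))

lemma AE_integral_operator_linear:
  assumes "k \<in> L2 unit_square" "g \<in> L2 unit_interval" "h \<in> L2 unit_interval"
  shows "AE \<tau> in unit_interval. integral_operator k (\<lambda>x. a * g x + b * h x) \<tau> =
    complex_of_real a * integral_operator k g \<tau> + complex_of_real b * integral_operator k h \<tau>"
  using AE_integrable_integral_operator[OF assms(1,2)] AE_integrable_integral_operator[OF assms(1,3)]
proof eventually_elim
  case (elim \<tau>)
  have "integral_operator k (\<lambda>x. a * g x + b * h x) \<tau> =
      (LINT \<sigma>|unit_interval. complex_of_real a * (k (\<tau>, \<sigma>) * complex_of_real (g \<sigma>)) +
         complex_of_real b * (k (\<tau>, \<sigma>) * complex_of_real (h \<sigma>)))"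
    unfolding integral_operator_def
    by (intro Bochner_Integration.integral_cong) (auto simp: algebra_simps)
  with elim show ?case
    by (simp add: integral_operator_def)
qed

lemma AE_integral_operator_diff:
  assumes "k \<in> L2 unit_square" "l \<in> L2 unit_square" "h \<in> L2 unit_interval"
  shows "AE \<tau> in unit_interval. integral_operator k h \<tau> - integral_operator l h \<tau> =
    integral_operator (\<lambda>x. k x - l x) h \<tau>"
  using AE_integrable_integral_operator[OF assms(1,3)] AE_integrable_integral_operator[OF assms(2,3)]
  by eventually_elim (simp add: integral_operator_def left_diff_distrib)

text \<open>Parseval's identity for almost every section \<open>k (\<tau>, \<cdot>)\<close>, integrated over \<open>\<tau>\<close>.\<close>

lemma sums_L2_norm_integral_operator_basis:
  assumes k: "k \<in> L2 unit_square"
  shows "(\<lambda>i. (L2_norm unit_interval (integral_operator k (basis i)))\<^sup>2) sums (L2_norm unit_square k)\<^sup>2"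
proof -
  note T = integral_operator_L2[OF k basis_L2]
  note [measurable] = L2_measurable[OF k] L2_measurable[OF T]
  \<comment> \<open>Computing in \<open>ennreal\<close> lets sum and integral commute
    unconditionally; summability of the real series is read off from the finite value
    afterwards.\<close>
  have "(\<Sum>i. ennreal ((L2_norm unit_interval (integral_operator k (basis i)))\<^sup>2)) =
      (\<Sum>i. \<integral>\<^sup>+\<tau>. ennreal ((norm (integral_operator k (basis i) \<tau>))\<^sup>2) \<partial>unit_interval)"
    by (simp add: L2_nn_integral[OF T])
  also have "\<dots> = (\<integral>\<^sup>+\<tau>. (\<Sum>i. ennreal ((norm (integral_operator k (basis i) \<tau>))\<^sup>2)) \<partial>unit_interval)"
    by (rule nn_integral_suminf[symmetric]) measurable
  also have "\<dots> = (\<integral>\<^sup>+\<tau>. \<integral>\<^sup>+\<sigma>. ennreal ((norm (k (\<tau>, \<sigma>)))\<^sup>2) \<partial>unit_interval \<partial>unit_interval)"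
  proof (rule nn_integral_cong_AE)
    show "AE \<tau> in unit_interval. (\<Sum>i. ennreal ((norm (integral_operator k (basis i) \<tau>))\<^sup>2)) =
        (\<integral>\<^sup>+\<sigma>. ennreal ((norm (k (\<tau>, \<sigma>)))\<^sup>2) \<partial>unit_interval)"
      using unit_square.AE_L2_section[OF k]
    proof eventually_elim
      case (elim \<tau>)
      then show ?case
        unfolding L2_nn_integral[OF elim] integral_operator_def
        by (intro suminf_ennreal_eq parseval_complex) auto
    qed
  qed
  also have "\<dots> = (\<integral>\<^sup>+x. ennreal ((norm (k x))\<^sup>2) \<partial>unit_square)"
    by (rule unit_interval.nn_integral_fst) measurable
  also have "\<dots> = ennreal ((L2_norm unit_square k)\<^sup>2)"
    by (rule L2_nn_integral[OF k])
  finally have eq: "(\<Sum>i. ennreal ((L2_norm unit_interval (integral_operator k (basis i)))\<^sup>2)) =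
      ennreal ((L2_norm unit_square k)\<^sup>2)" .
  then have summable: "summable (\<lambda>i. (L2_norm unit_interval (integral_operator k (basis i)))\<^sup>2)"
    by (intro summable_suminf_not_top) auto
  moreover have "(\<Sum>i. (L2_norm unit_interval (integral_operator k (basis i)))\<^sup>2) = (L2_norm unit_square k)\<^sup>2"
    using eq by (subst (asm) suminf_ennreal2[OF _ summable]) (auto simp: suminf_nonneg summable)
  ultimately show ?thesis
    by (metis summable_sums)
qed

lemma hilbert_schmidt_integral_operator:
  assumes "k \<in> L2 unit_square"
  shows "hilbert_schmidt (integral_operator k)"
  unfolding hilbert_schmidt_def
proof (intro conjI ballI allI)
  show "\<exists>C. \<forall>h\<in>L2 unit_interval. L2_norm unit_interval (integral_operator k h) \<le> C * L2_norm unit_interval h"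
    using L2_norm_integral_operator_le[OF assms] by blast
  show "summable (\<lambda>i. (L2_norm unit_interval (integral_operator k (basis i)))\<^sup>2)"
    using sums_L2_norm_integral_operator_basis[OF assms] by (rule sums_summable)
qed (auto intro: integral_operator_L2[OF assms] AE_integral_operator_linear[OF assms])

lemma HS_norm_square:
  assumes "summable (\<lambda>i. (L2_norm unit_interval (T (basis i)))\<^sup>2)"
  shows "(HS_norm T)\<^sup>2 = (\<Sum>i. (L2_norm unit_interval (T (basis i)))\<^sup>2)"
  unfolding HS_norm_def by (intro real_sqrt_pow2 suminf_nonneg assms) simp

text \<open>The difference of the operators agrees almost everywhere with the operator of the
  difference kernel, and \<open>HS_norm\<close> depends only on L2 norms of images of basis
  vectors.\<close>

lemma HS_norm_integral_operator_diff:
  assumes k: "k \<in> L2 unit_square" and l: "l \<in> L2 unit_square"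
  shows "(HS_norm (\<lambda>h \<tau>. integral_operator k h \<tau> - integral_operator l h \<tau>))\<^sup>2 =
    (L2_norm unit_square (\<lambda>x. k x - l x))\<^sup>2"
proof -
  have kl: "(\<lambda>x. k x - l x) \<in> L2 unit_square"
    by (rule L2_diff[OF k l])
  have "L2_norm unit_interval (\<lambda>\<tau>. integral_operator k (basis i) \<tau> - integral_operator l (basis i) \<tau>) =
      L2_norm unit_interval (integral_operator (\<lambda>x. k x - l x) (basis i))" for i
    by (intro L2_norm_cong_AE AE_integral_operator_diff k l basis_L2 borel_measurable_diff L2_measurable
        integral_operator_L2 kl)
  then show ?thesis
    using sums_L2_norm_integral_operator_basis[OF kl]
    by (subst HS_norm_square) (auto simp: sums_iff)
qed

section \<open>Autocovariance kernels\<close>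

lemma space_L2_borel: "space (L2_borel M) = L2 M"
  unfolding L2_borel_def by (rule space_measure_of) auto

text \<open>Superlevel sets of the norm are open by the triangle inequality, hence among the
  generators of \<open>L2_borel\<close>; around \<open>g\<close> the radius
  \<open>L2_norm M g - a\<close> works.\<close>

lemma measurable_L2_norm:
  "L2_norm M \<in> borel_measurable
    (L2_borel M :: ('a \<Rightarrow> 'b::{real_normed_div_algebra,banach,second_countable_topology}) measure)"
proof -
  let ?G = "{U. U \<subseteq> L2 M \<and> (\<forall>g\<in>U. \<exists>\<epsilon>>0. \<forall>h\<in>L2 M. L2_norm M (\<lambda>x. h x - g x :: 'b) < \<epsilon> \<longrightarrow> h \<in> U)}"
  have G: "?G \<subseteq> Pow (L2 M)"
    by auto
  show ?thesis
    unfolding borel_measurable_iff_greater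
  proof
    fix a
    let ?U = "{h \<in> L2 M. a < L2_norm M (h :: 'a \<Rightarrow> 'b)}"
    have "?U \<in> ?G"
    proof safe
      fix g :: "'a \<Rightarrow> 'b" assume g: "g \<in> L2 M" "a < L2_norm M g"
      have "a < L2_norm M h" if "h \<in> L2 M" "L2_norm M (\<lambda>x. h x - g x) < L2_norm M g - a" for h
        using L2_norm_triangle_sub[OF g(1) that(1)] that(2) L2_norm_minus_commute[of M h g] by linarith
      with g(2) show "\<exists>\<epsilon>>0. \<forall>h\<in>L2 M. L2_norm M (\<lambda>x. h x - g x) < \<epsilon> \<longrightarrow> h \<in> ?U"
        by (intro exI[of _ "L2_norm M g - a"]) auto
    qed
    then have "?U \<in> sets (L2_borel M)"
      unfolding L2_borel_def sets_measure_of[OF G] by (rule sigma_sets.Basic)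
    then show "{h \<in> space (L2_borel M). a < L2_norm M (h :: 'a \<Rightarrow> 'b)} \<in> sets (L2_borel M)"
      by (simp add: space_L2_borel)
  qed
qed

text \<open>Stationarity for the index set \<open>{0}\<close> and shift \<open>t\<close>, applied to
  the measurable functional that squares the norm of coordinate 0.\<close>

lemma strictly_stationary_nn_integral_L2_norm:
  assumes X: "functional_time_series P X" and stat: "strictly_stationary P X"
  shows "(\<integral>\<^sup>+w. ennreal ((L2_norm unit_interval (X t w))\<^sup>2) \<partial>P) =
    (\<integral>\<^sup>+w. ennreal ((L2_norm unit_interval (X 0 w))\<^sup>2) \<partial>P)"
proof -
  let ?N = "PiM {0::int} (\<lambda>_. L2_borel unit_interval :: (real \<Rightarrow> real) measure)"
  let ?\<phi> = "\<lambda>x :: int \<Rightarrow> real \<Rightarrow> real. ennreal ((L2_norm unit_interval (x 0))\<^sup>2)"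
  have [measurable]: "X s \<in> measurable P (L2_borel unit_interval)" for s
    using X by (auto simp: functional_time_series_def)
  note [measurable] = measurable_L2_norm
  have R: "(\<lambda>w. \<lambda>s\<in>{0}. X (s + h) w) \<in> measurable P ?N" for h
    by measurable
  have \<phi>: "?\<phi> \<in> borel_measurable ?N"
    by measurable
  have "(\<integral>\<^sup>+w. ?\<phi> (\<lambda>s\<in>{0}. X (s + h) w) \<partial>P) = (\<integral>\<^sup>+x. ?\<phi> x \<partial>distr P ?N (\<lambda>w. \<lambda>s\<in>{0}. X (s + h) w))" for h
    by (rule nn_integral_distr[symmetric, OF R]) (simp add: \<phi>)
  moreover have "distr P ?N (\<lambda>w. \<lambda>s\<in>{0}. X (s + t) w) = distr P ?N (\<lambda>w. \<lambda>s\<in>{0}. X (s + 0) w)"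
    using stat unfolding strictly_stationary_def by simp
  ultimately have "(\<integral>\<^sup>+w. ?\<phi> (\<lambda>s\<in>{0}. X (s + t) w) \<partial>P) = (\<integral>\<^sup>+w. ?\<phi> (\<lambda>s\<in>{0}. X (s + 0) w) \<partial>P)"
    by metis
  then show ?thesis
    by simp
qed

text \<open>Cauchy-Schwarz without an integrability hypothesis: if the product is not integrable,
  the left side is 0 by default.\<close>

lemma integral_product_square_le:
  fixes Y Z :: "'a \<Rightarrow> real"
  assumes [measurable]: "Y \<in> borel_measurable M" "Z \<in> borel_measurable M"
  shows "ennreal ((LINT w|M. Y w * Z w)\<^sup>2) \<le>
    (\<integral>\<^sup>+w. ennreal ((Y w)\<^sup>2) \<partial>M) * (\<integral>\<^sup>+w. ennreal ((Z w)\<^sup>2) \<partial>M)"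
proof -
  have "ennreal ((LINT w|M. Y w * Z w)\<^sup>2) = (ennreal \<bar>LINT w|M. Y w * Z w\<bar>)\<^sup>2"
    by (simp add: ennreal_power)
  also have "\<dots> \<le> (\<integral>\<^sup>+w. ennreal \<bar>Y w\<bar> * ennreal \<bar>Z w\<bar> \<partial>M)\<^sup>2"
  proof (cases "integrable M (\<lambda>w. Y w * Z w)")
    case True
    then show ?thesis
      using integral_norm_bound_ennreal[OF True]
      by (intro power_mono) (auto simp: abs_mult ennreal_mult)
  qed (simp add: not_integrable_integral_eq)
  also have "\<dots> \<le> (\<integral>\<^sup>+w. (ennreal \<bar>Y w\<bar>)\<^sup>2 \<partial>M) * (\<integral>\<^sup>+w. (ennreal \<bar>Z w\<bar>)\<^sup>2 \<partial>M)"
    by (rule Cauchy_Schwarz_nn_integral) auto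
  finally show ?thesis
    by (simp add: ennreal_power)
qed

lemma (in prob_space) expectation_square_le:
  fixes Z :: "'a \<Rightarrow> real"
  assumes "Z \<in> borel_measurable M"
  shows "ennreal ((LINT w|M. Z w)\<^sup>2) \<le> (\<integral>\<^sup>+w. ennreal ((Z w)\<^sup>2) \<partial>M)"
  using integral_product_square_le[OF assms, of "\<lambda>_. 1"] by (simp add: emeasure_space_1)

text \<open>Cauchy-Schwarz over the probability space bounds the squared kernel by a product of one
  function of \<open>\<tau>\<close> and one of \<open>\<sigma>\<close>, each of finite integral
  because the second moment of the norm is finite at every time.\<close>

lemma autocov_kernel_L2:
  assumes P: "prob_space P" and X: "functional_time_series P X" and stat: "strictly_stationary P X"
    and moment: "integrable P (\<lambda>w. (L2_norm unit_interval (X 0 w))\<^sup>2)"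
  shows "autocov_kernel P X t \<in> L2 unit_square"
proof -
  interpret P: prob_space P by fact
  interpret PI: pair_prob_space P unit_interval ..
  have joint: "(\<lambda>(w, \<tau>). X s w \<tau>) \<in> borel_measurable (P \<Otimes>\<^sub>M unit_interval)" for s
    using X by (auto simp: functional_time_series_def)
  have Xm [measurable]: "(\<lambda>z. X s (u z) (v z)) \<in> borel_measurable N"
    if "u \<in> measurable N P" "v \<in> measurable N unit_interval" for s N and u :: "'c \<Rightarrow> 'a" and v
    using measurable_compose[OF measurable_Pair[OF that] joint[of s]] by simp
  have L2X: "X s w \<in> L2 unit_interval" if "w \<in> space P" for s w
  proof -
    have "X s \<in> measurable P (L2_borel unit_interval)"
      using X by (simp add: functional_time_series_def)
    from measurable_space[OF this that] show ?thesis
      by (simp add: space_L2_borel)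
  qed
  \<comment> \<open>Tonelli turns this into the second moment of the norm of \<open>X s\<close>,
    which stationarity equates with that of \<open>X 0\<close>.\<close>
  have fin: "(\<integral>\<^sup>+\<tau>. \<integral>\<^sup>+w. ennreal ((X s w \<tau>)\<^sup>2) \<partial>P \<partial>unit_interval) < \<infinity>" for s
  proof -
    have "(\<integral>\<^sup>+\<tau>. \<integral>\<^sup>+w. ennreal ((X s w \<tau>)\<^sup>2) \<partial>P \<partial>unit_interval) =
        (\<integral>\<^sup>+w. \<integral>\<^sup>+\<tau>. ennreal ((X s w \<tau>)\<^sup>2) \<partial>unit_interval \<partial>P)"
      by (rule PI.Fubini') measurable
    also have "\<dots> = (\<integral>\<^sup>+w. ennreal ((L2_norm unit_interval (X s w))\<^sup>2) \<partial>P)"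
      using L2_nn_integral[OF L2X] by (intro nn_integral_cong) simp
    also have "\<dots> = (\<integral>\<^sup>+w. ennreal ((L2_norm unit_interval (X 0 w))\<^sup>2) \<partial>P)"
      by (rule strictly_stationary_nn_integral_L2_norm[OF X stat])
    also have "\<dots> < \<infinity>"
      using moment by (subst nn_integral_eq_integral) auto
    finally show ?thesis .
  qed
  define \<mu> where "\<mu> = mean_function P X"
  have \<mu>_eq: "\<mu> \<tau> = (LINT w|P. X 0 w \<tau>)" for \<tau>
    by (simp add: \<mu>_def mean_function_def)
  have [measurable]: "\<mu> \<in> borel_measurable unit_interval"
    unfolding \<mu>_eq[abs_def] by measurable
  \<comment> \<open>The pointwise variance, kept in \<open>ennreal\<close> so that it makes sense
    also at points where it is infinite.\<close>
  define V where "V s \<tau> = (\<integral>\<^sup>+w. ennreal ((X s w \<tau> - \<mu> \<tau>)\<^sup>2) \<partial>P)" for s \<tau>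
  have [measurable]: "V s \<in> borel_measurable unit_interval" for s
    unfolding V_def[abs_def] by measurable
  have V: "(\<integral>\<^sup>+\<tau>. V s \<tau> \<partial>unit_interval) < \<infinity>" for s
  proof -
    have "(\<integral>\<^sup>+\<tau>. V s \<tau> \<partial>unit_interval) \<le>
        (\<integral>\<^sup>+\<tau>. 2 * (\<integral>\<^sup>+w. ennreal ((X s w \<tau>)\<^sup>2) \<partial>P) + 2 * (\<integral>\<^sup>+w. ennreal ((X 0 w \<tau>)\<^sup>2) \<partial>P) \<partial>unit_interval)"
    proof (rule nn_integral_mono)
      fix \<tau> :: real assume [measurable]: "\<tau> \<in> space unit_interval"
      have "V s \<tau> \<le> (\<integral>\<^sup>+w. 2 * ennreal ((X s w \<tau>)\<^sup>2) + 2 * ennreal ((\<mu> \<tau>)\<^sup>2) \<partial>P)"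
        unfolding V_def
      proof (rule nn_integral_mono)
        fix w
        have "ennreal ((X s w \<tau> - \<mu> \<tau>)\<^sup>2) \<le> ennreal (2 * (X s w \<tau>)\<^sup>2 + 2 * (\<mu> \<tau>)\<^sup>2)"
          using norm_diff_square_le[of "X s w \<tau>" "\<mu> \<tau>"] by (intro ennreal_leI) simp
        also have "\<dots> = 2 * ennreal ((X s w \<tau>)\<^sup>2) + 2 * ennreal ((\<mu> \<tau>)\<^sup>2)"
          by (simp add: ennreal_mult)
        finally show "ennreal ((X s w \<tau> - \<mu> \<tau>)\<^sup>2) \<le> 2 * ennreal ((X s w \<tau>)\<^sup>2) + 2 * ennreal ((\<mu> \<tau>)\<^sup>2)" .
      qed
      also have "\<dots> = 2 * (\<integral>\<^sup>+w. ennreal ((X s w \<tau>)\<^sup>2) \<partial>P) + 2 * ennreal ((\<mu> \<tau>)\<^sup>2)"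
        by (subst nn_integral_add) (auto simp: nn_integral_cmult P.emeasure_space_1)
      also have "\<dots> \<le> 2 * (\<integral>\<^sup>+w. ennreal ((X s w \<tau>)\<^sup>2) \<partial>P) + 2 * (\<integral>\<^sup>+w. ennreal ((X 0 w \<tau>)\<^sup>2) \<partial>P)"
        \<comment> \<open>Jensen for the square; it holds at every point, since a non-integrable
          \<open>X 0 w \<tau>\<close> has mean 0 by default.\<close>
        unfolding \<mu>_eq by (intro add_left_mono mult_left_mono P.expectation_square_le) auto
      finally show "V s \<tau> \<le> 2 * (\<integral>\<^sup>+w. ennreal ((X s w \<tau>)\<^sup>2) \<partial>P) + 2 * (\<integral>\<^sup>+w. ennreal ((X 0 w \<tau>)\<^sup>2) \<partial>P)" .
    qed
    also have "\<dots> = 2 * (\<integral>\<^sup>+\<tau>. \<integral>\<^sup>+w. ennreal ((X s w \<tau>)\<^sup>2) \<partial>P \<partial>unit_interval) +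
        2 * (\<integral>\<^sup>+\<tau>. \<integral>\<^sup>+w. ennreal ((X 0 w \<tau>)\<^sup>2) \<partial>P \<partial>unit_interval)"
      by (subst nn_integral_add) (auto simp: nn_integral_cmult)
    also have "\<dots> < \<infinity>"
      using fin[of s] fin[of 0] by (simp add: ennreal_mult_less_top)
    finally show ?thesis .
  qed
  have meas: "autocov_kernel P X t \<in> borel_measurable unit_square"
    unfolding autocov_kernel_def \<mu>_def[symmetric] by measurable
  show ?thesis
  proof (rule unit_interval.L2I_pair[OF meas])
    have "(\<integral>\<^sup>+\<tau>. \<integral>\<^sup>+\<sigma>. ennreal ((norm (autocov_kernel P X t (\<tau>, \<sigma>)))\<^sup>2) \<partial>unit_interval \<partial>unit_interval)
        \<le> (\<integral>\<^sup>+\<tau>. \<integral>\<^sup>+\<sigma>. V t \<tau> * V 0 \<sigma> \<partial>unit_interval \<partial>unit_interval)"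
    proof (intro nn_integral_mono)
      fix \<tau> \<sigma> :: real assume [measurable]: "\<tau> \<in> space unit_interval" "\<sigma> \<in> space unit_interval"
      show "ennreal ((norm (autocov_kernel P X t (\<tau>, \<sigma>)))\<^sup>2) \<le> V t \<tau> * V 0 \<sigma>"
        using integral_product_square_le[of "\<lambda>w. X t w \<tau> - \<mu> \<tau>" P "\<lambda>w. X 0 w \<sigma> - \<mu> \<sigma>"]
        by (simp add: autocov_kernel_def V_def \<mu>_def)
    qed
    also have "\<dots> = (\<integral>\<^sup>+\<tau>. V t \<tau> \<partial>unit_interval) * (\<integral>\<^sup>+\<sigma>. V 0 \<sigma> \<partial>unit_interval)"
      by (simp add: nn_integral_cmult nn_integral_multc)
    also have "\<dots> < \<infinity>"
      using V[of t] V[of 0] by (simp add: ennreal_mult_less_top)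
    finally show "(\<integral>\<^sup>+\<tau>. \<integral>\<^sup>+\<sigma>. ennreal ((norm (autocov_kernel P X t (\<tau>, \<sigma>)))\<^sup>2) \<partial>unit_interval \<partial>unit_interval) < \<infinity>" .
  qed
qed

text \<open>Each finite partial sum has norm at most \<open>?C\<close>, as the exponential factors
  have modulus 1. The triangle inequality adds only the approximation error, which vanishes along
  the net of finite sets.\<close>

lemma L2_norm_spectral_density_le:
  assumes f: "spectral_density_kernel P X f"
    and r: "\<And>t. autocov_kernel P X t \<in> L2 unit_square"
    and summable: "(\<lambda>t. L2_norm unit_square (autocov_kernel P X t)) summable_on UNIV"
  shows "L2_norm unit_square (f \<omega>) \<le>
    1 / (2 * pi) * (\<Sum>\<^sub>\<infinity>t. L2_norm unit_square (autocov_kernel P X t))" (is "_ \<le> ?C")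
proof -
  define e where "e t x = 1 / complex_of_real (2 * pi) * (exp (- \<i> * complex_of_real \<omega> * of_int t) *
      complex_of_real (autocov_kernel P X t x))" for t x
  have f\<omega>: "f \<omega> \<in> L2 unit_square"
    and lim: "((\<lambda>S. L2_norm unit_square (\<lambda>x. f \<omega> x - (\<Sum>t\<in>S. e t x))) \<longlongrightarrow> 0) (finite_subsets_at_top UNIV)"
    using f by (auto simp: spectral_density_kernel_def e_def sum_distrib_left)
  have e: "e t \<in> L2 unit_square" for t
    unfolding e_def[abs_def] by (intro L2_mult_left L2_of_real r)
  have norm_e: "L2_norm unit_square (e t) = 1 / (2 * pi) * L2_norm unit_square (autocov_kernel P X t)" for t
    unfolding e_def[abs_def] L2_norm_mult_left L2_norm_of_real by (simp add: norm_divide)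
  have "L2_norm unit_square (f \<omega>) \<le> ?C + L2_norm unit_square (\<lambda>x. f \<omega> x - (\<Sum>t\<in>S. e t x))" if "finite S" for S
  proof -
    have "L2_norm unit_square (f \<omega>) \<le> L2_norm unit_square (\<lambda>x. \<Sum>t\<in>S. e t x) +
        L2_norm unit_square (\<lambda>x. f \<omega> x - (\<Sum>t\<in>S. e t x))"
      by (intro L2_norm_triangle_sub f\<omega> L2_sum e)
    moreover have "L2_norm unit_square (\<lambda>x. \<Sum>t\<in>S. e t x) \<le> (\<Sum>t\<in>S. L2_norm unit_square (e t))"
      by (intro L2_norm_sum_le e)
    moreover have "(\<Sum>t\<in>S. L2_norm unit_square (e t)) = 1 / (2 * pi) * (\<Sum>t\<in>S. L2_norm unit_square (autocov_kernel P X t))"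
      by (simp add: norm_e sum_distrib_left)
    moreover have "(\<Sum>t\<in>S. L2_norm unit_square (autocov_kernel P X t)) \<le> (\<Sum>\<^sub>\<infinity>t. L2_norm unit_square (autocov_kernel P X t))"
      using summable that by (intro finite_sum_le_infsum) auto
    then have "1 / (2 * pi) * (\<Sum>t\<in>S. L2_norm unit_square (autocov_kernel P X t)) \<le> ?C"
      by (intro mult_left_mono) auto
    ultimately show ?thesis
      by linarith
  qed
  then have "\<forall>\<^sub>F S in finite_subsets_at_top UNIV.
      L2_norm unit_square (f \<omega>) \<le> ?C + L2_norm unit_square (\<lambda>x. f \<omega> x - (\<Sum>t\<in>S. e t x))"
    by (intro eventually_finite_subsets_at_top_weakI) auto
  from tendsto_lowerbound[OF tendsto_add[OF tendsto_const lim] this] show ?thesis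
    by simp
qed

section \<open>Averaging over frequencies\<close>

text \<open>A finite measure space of mass 2 pi in place of set integrals, so that product-measure
  theorems apply directly.\<close>

abbreviation frequencies :: "real measure" where
  "frequencies \<equiv> restrict_space lborel {-pi..pi}"

lemma emeasure_frequencies: "emeasure frequencies (space frequencies) = ennreal (2 * pi)"
  by (simp add: emeasure_restrict_space space_restrict_space)

interpretation frequencies: finite_measure frequencies
  by standard (simp only: emeasure_frequencies, simp)

lemma measure_frequencies: "measure frequencies (space frequencies) = 2 * pi"
  using emeasure_frequencies by (simp only: measure_def enn2real_ennreal) simp

interpretation frequencies_unit: pair_sigma_finite frequencies unit_interval
  by standard

interpretation frequencies_square: pair_sigma_finite frequencies unit_square
  by standard

interpretation square_frequencies: pair_sigma_finite unit_square frequencies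
  by standard

interpretation unit_frequencies_unit: pair_sigma_finite unit_interval "frequencies \<Otimes>\<^sub>M unit_interval"
  by standard

lemma set_integral_frequencies:
  fixes g :: "real \<Rightarrow> 'b::{banach,second_countable_topology}"
  shows "(LINT \<omega>:{-pi..pi}|lborel. g \<omega>) = (LINT \<omega>|frequencies. g \<omega>)"
  by (simp add: set_lebesgue_integral_def integral_restrict_space)

text \<open>With the constant under the integral the mean kernel is a kernel integral against a
  constant function, and the general L2 bound applies.\<close>

lemma mean_kernel_eq: "mean_kernel f x = (LINT \<omega>|frequencies. f \<omega> x * (1 / complex_of_real (2 * pi)))"
  by (simp add: mean_kernel_def set_integral_frequencies)

lemma (in finite_measure) L2_const: "(\<lambda>x. c) \<in> L2 M"
  by (simp add: L2_def)

text \<open>The bias-variance decomposition for total mass \<open>\<mu>\<close>. With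
  \<open>c\<close> arbitrary it yields optimality of the mean, with \<open>c = m\<close> the value
  of the minimum.\<close>

lemma (in finite_measure) integral_norm_diff_const_square:
  fixes \<phi> :: "'a \<Rightarrow> complex"
  assumes \<phi>: "\<phi> \<in> L2 M" and \<mu>: "measure M (space M) = \<mu>" and pos: "\<mu> > 0"
  defines "m \<equiv> (LINT x|M. \<phi> x) / complex_of_real \<mu>"
  shows "(LINT x|M. (cmod (\<phi> x - c))\<^sup>2) = (LINT x|M. (cmod (\<phi> x))\<^sup>2)
    - \<mu> * (cmod m)\<^sup>2 + \<mu> * (cmod (c - m))\<^sup>2"
proof -
  have expand: "(cmod (z - w))\<^sup>2 = (cmod z)\<^sup>2 - 2 * Re (cnj w * z) + (cmod w)\<^sup>2" for z w
    unfolding cmod_power2 by (simp add: power2_eq_square algebra_simps)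
  have int: "integrable M \<phi>"
    using L2_mult_integrable[OF \<phi> L2_const[of 1]] by simp
  have "(LINT x|M. (cmod (\<phi> x - c))\<^sup>2) =
      (LINT x|M. (cmod (\<phi> x))\<^sup>2) - 2 * Re (cnj c * (LINT x|M. \<phi> x)) + \<mu> * (cmod c)\<^sup>2"
    unfolding expand using int L2_integrable[OF \<phi>] by (simp add: \<mu>)
  also have "(LINT x|M. \<phi> x) = complex_of_real \<mu> * m"
    using pos by (simp add: m_def)
  also have "Re (cnj c * (complex_of_real \<mu> * m)) = \<mu> * Re (cnj m * c)"
    by (simp add: algebra_simps)
  finally show ?thesis
    unfolding expand[of c m] by (simp add: algebra_simps)
qed

lemma L2_norm_diff_square_le:
  fixes g h :: "'a \<Rightarrow> 'b::{real_normed_div_algebra,banach,second_countable_topology}"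
  assumes "g \<in> L2 M" "h \<in> L2 M"
  shows "(L2_norm M (\<lambda>x. g x - h x))\<^sup>2 \<le> 2 * (L2_norm M g)\<^sup>2 + 2 * (L2_norm M h)\<^sup>2"
proof -
  have "L2_norm M (\<lambda>x. g x - h x) \<le> L2_norm M g + L2_norm M h"
    using L2_norm_triangle[OF assms(1) L2_mult_left[OF assms(2), of "-1"]] L2_norm_mult_left[of M "-1" h]
    by simp
  then have "(L2_norm M (\<lambda>x. g x - h x))\<^sup>2 \<le> (L2_norm M g + L2_norm M h)\<^sup>2"
    by (intro power_mono) auto
  also have "\<dots> \<le> 2 * (L2_norm M g)\<^sup>2 + 2 * (L2_norm M h)\<^sup>2"
    using norm_add_square_le[of "L2_norm M g" "L2_norm M h"] by simp
  finally show ?thesis .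
qed

text \<open>All that the averaging argument takes from the time series; probability and stationarity
  enter only through \<open>C\<close>, \<open>L2\<close> membership and joint measurability.\<close>

locale bounded_kernel_family =
  fixes f :: "real \<Rightarrow> real \<times> real \<Rightarrow> complex" and C :: real
  assumes measurable_family: "(\<lambda>(\<omega>, x). f \<omega> x) \<in> borel_measurable (lborel \<Otimes>\<^sub>M unit_square)"
    and family_L2: "f \<omega> \<in> L2 unit_square"
    and L2_norm_family_le: "L2_norm unit_square (f \<omega>) \<le> C"
begin

section \<open>Joint measurability and square integrability of the family\<close>

lemma family_measurable [measurable (raw)]:
  assumes "u \<in> measurable N frequencies" "v \<in> measurable N unit_square"
  shows "(\<lambda>z. f (u z) (v z)) \<in> borel_measurable N"
proof -
  have "(\<lambda>\<omega>. \<omega>) \<in> measurable frequencies lborel"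
    by (rule measurable_restrict_space1) simp
  note measurable_compose[OF assms(1) this]
  from measurable_compose[OF measurable_Pair[OF this assms(2)] measurable_family] show ?thesis
    by simp
qed

lemma nn_integral_family:
  "(\<integral>\<^sup>+\<omega>. \<integral>\<^sup>+x. ennreal ((norm (f \<omega> x))\<^sup>2) \<partial>unit_square \<partial>frequencies) < \<infinity>"
proof -
  have "(\<integral>\<^sup>+\<omega>. \<integral>\<^sup>+x. ennreal ((norm (f \<omega> x))\<^sup>2) \<partial>unit_square \<partial>frequencies) \<le>
      (\<integral>\<^sup>+\<omega>. ennreal (C\<^sup>2) \<partial>frequencies)"
    unfolding L2_nn_integral[OF family_L2]
    by (intro nn_integral_mono ennreal_leI power_mono L2_norm_family_le) auto
  also have "\<dots> < \<infinity>"
    by (simp only: nn_integral_const emeasure_frequencies) (simp add: ennreal_mult_less_top)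
  finally show ?thesis .
qed

lemma joint_L2: "(\<lambda>(\<omega>, x). f \<omega> x) \<in> L2 (frequencies \<Otimes>\<^sub>M unit_square)"
  using nn_integral_family by (intro unit_square.P.L2I_pair) auto

lemma mean_kernel_L2: "mean_kernel f \<in> L2 unit_square"
  using square_frequencies.L2_kernel_integral[OF frequencies_square.L2_swap[OF joint_L2]
      frequencies.L2_const[of "1 / complex_of_real (2 * pi)"]]
  by (simp add: mean_kernel_eq[abs_def])

text \<open>Reordering the variables makes almost every slice at fixed \<open>\<tau>\<close> square
  integrable in frequency and \<open>\<sigma>\<close> jointly, which is what Fubini at that
  \<open>\<tau>\<close> requires.\<close>

lemma joint_section_L2:
  "(\<lambda>(\<tau>, \<omega>, \<sigma>). f \<omega> (\<tau>, \<sigma>)) \<in> L2 (unit_interval \<Otimes>\<^sub>M (frequencies \<Otimes>\<^sub>M unit_interval))"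
proof (rule frequencies_unit.P.L2I_pair)
  have "(\<integral>\<^sup>+\<tau>. \<integral>\<^sup>+z. ennreal ((norm (f (fst z) (\<tau>, snd z)))\<^sup>2) \<partial>(frequencies \<Otimes>\<^sub>M unit_interval) \<partial>unit_interval) =
      (\<integral>\<^sup>+\<tau>. \<integral>\<^sup>+\<omega>. \<integral>\<^sup>+\<sigma>. ennreal ((norm (f \<omega> (\<tau>, \<sigma>)))\<^sup>2) \<partial>unit_interval \<partial>frequencies \<partial>unit_interval)"
    by (intro nn_integral_cong, subst unit_interval.nn_integral_fst[symmetric]) auto
  also have "\<dots> = (\<integral>\<^sup>+\<omega>. \<integral>\<^sup>+\<tau>. \<integral>\<^sup>+\<sigma>. ennreal ((norm (f \<omega> (\<tau>, \<sigma>)))\<^sup>2) \<partial>unit_interval \<partial>unit_interval \<partial>frequencies)"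
    by (rule frequencies_unit.Fubini') measurable
  also have "\<dots> = (\<integral>\<^sup>+\<omega>. \<integral>\<^sup>+x. ennreal ((norm (f \<omega> x))\<^sup>2) \<partial>unit_square \<partial>frequencies)"
    by (intro nn_integral_cong unit_interval.nn_integral_fst) measurable
  also have "\<dots> < \<infinity>"
    by (rule nn_integral_family)
  finally show "(\<integral>\<^sup>+\<tau>. \<integral>\<^sup>+z. ennreal ((norm (case (\<tau>, z) of (\<tau>, \<omega>, \<sigma>) \<Rightarrow> f \<omega> (\<tau>, \<sigma>)))\<^sup>2)
      \<partial>(frequencies \<Otimes>\<^sub>M unit_interval) \<partial>unit_interval) < \<infinity>"
    by (simp add: case_prod_beta')
qed measurable

lemma integral_operator_family_measurable [measurable (raw)]:
  assumes [measurable]: "u \<in> measurable N frequencies" "v \<in> measurable N unit_interval"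
    and [measurable]: "h \<in> borel_measurable unit_interval"
  shows "(\<lambda>z. integral_operator (f (u z)) h (v z)) \<in> borel_measurable N"
  unfolding integral_operator_def by measurable

text \<open>Fubini in frequency and \<open>\<sigma>\<close> at fixed \<open>\<tau>\<close>. The null
  set depends on \<open>h\<close>, which is harmless because basis vectors are treated one at a
  time.\<close>

lemma AE_integral_operator_mean_kernel:
  assumes h: "h \<in> L2 unit_interval"
  shows "AE \<tau> in unit_interval. (\<lambda>\<omega>. integral_operator (f \<omega>) h \<tau>) \<in> L2 frequencies \<and>
    integral_operator (mean_kernel f) h \<tau> =
      (LINT \<omega>|frequencies. integral_operator (f \<omega>) h \<tau>) / complex_of_real (2 * pi)"
  using unit_frequencies_unit.AE_L2_section[OF joint_section_L2]
proof eventually_elim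
  case (elim \<tau>)
  note hc = L2_of_real[OF h]
  note [measurable] = L2_measurable[OF hc]
  have sec: "(\<lambda>(\<omega>, \<sigma>). f \<omega> (\<tau>, \<sigma>)) \<in> L2 (frequencies \<Otimes>\<^sub>M unit_interval)"
    using elim by simp
  \<comment> \<open>Finite mass of the frequencies makes \<open>h\<close>, read as a function of
    both variables, square integrable, so its product with the slice is integrable.\<close>
  have "(\<integral>\<^sup>+\<omega>. \<integral>\<^sup>+\<sigma>. ennreal ((norm (complex_of_real (h \<sigma>)))\<^sup>2) \<partial>unit_interval \<partial>frequencies) < \<infinity>"
    unfolding L2_nn_integral[OF hc] nn_integral_const emeasure_frequencies
    by (simp add: ennreal_mult_less_top)
  then have "(\<lambda>(\<omega>, \<sigma>). complex_of_real (h \<sigma>)) \<in> L2 (frequencies \<Otimes>\<^sub>M unit_interval)"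
    by (intro unit_interval.L2I_pair) auto
  from L2_mult_integrable[OF sec this]
  have int: "integrable (frequencies \<Otimes>\<^sub>M unit_interval) (\<lambda>(\<omega>, \<sigma>). f \<omega> (\<tau>, \<sigma>) * complex_of_real (h \<sigma>))"
    by (simp add: case_prod_beta')
  have "integral_operator (mean_kernel f) h \<tau> =
      (LINT \<sigma>|unit_interval. (LINT \<omega>|frequencies. f \<omega> (\<tau>, \<sigma>) * complex_of_real (h \<sigma>)) / complex_of_real (2 * pi))"
    unfolding integral_operator_def mean_kernel_eq by (intro Bochner_Integration.integral_cong) auto
  also have "\<dots> = (LINT \<omega>|frequencies. integral_operator (f \<omega>) h \<tau>) / complex_of_real (2 * pi)"
    using frequencies_unit.Fubini_integral[OF int] by (simp add: integral_operator_def)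
  finally show ?case
    using frequencies_unit.L2_kernel_integral[OF sec hc] by (simp add: integral_operator_def)
qed

text \<open>Guards against the default value: were the integrand of \<open>M2\<close> not
  integrable, a competitor would score 0. Once it is measurable and bounded, Tonelli gives a sum
  over basis vectors that can be compared term by term.\<close>

lemma M2_eq_suminf:
  assumes G: "\<And>i. G (basis i) \<in> L2 unit_interval"
    and summable: "summable (\<lambda>i. (L2_norm unit_interval (G (basis i)))\<^sup>2)"
  shows "ennreal (M2 (\<lambda>\<omega>. integral_operator (f \<omega>)) G) =
    (\<Sum>i. \<integral>\<^sup>+\<tau>. \<integral>\<^sup>+\<omega>. ennreal ((cmod (integral_operator (f \<omega>) (basis i) \<tau> - G (basis i) \<tau>))\<^sup>2)
       \<partial>frequencies \<partial>unit_interval)"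
proof -
  note [measurable] = L2_measurable[OF G]
  define d where "d i \<omega> \<tau> = integral_operator (f \<omega>) (basis i) \<tau> - G (basis i) \<tau>" for i \<omega> \<tau>
  have [measurable]: "(\<lambda>z. d i (u z) (v z)) \<in> borel_measurable N"
    if [measurable]: "u \<in> measurable N frequencies" "v \<in> measurable N unit_interval" for i N u v
    unfolding d_def by measurable
  define H where "H \<omega> = (HS_norm (\<lambda>h \<tau>. integral_operator (f \<omega>) h \<tau> - G h \<tau>))\<^sup>2" for \<omega>
  have d_L2: "d i \<omega> \<in> L2 unit_interval" for i \<omega>
    unfolding d_def[abs_def] by (intro L2_diff G integral_operator_L2 family_L2 basis_L2)
  have d_le: "(L2_norm unit_interval (d i \<omega>))\<^sup>2 \<le>
      2 * (L2_norm unit_interval (integral_operator (f \<omega>) (basis i)))\<^sup>2 +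
      2 * (L2_norm unit_interval (G (basis i)))\<^sup>2" for i \<omega>
    unfolding d_def[abs_def] by (intro L2_norm_diff_square_le G integral_operator_L2 family_L2 basis_L2)
  note sums = sums_add[OF sums_mult[OF sums_L2_norm_integral_operator_basis[OF family_L2], of 2]
      sums_mult[OF summable_sums[OF summable], of 2]]
  have d_summable: "summable (\<lambda>i. (L2_norm unit_interval (d i \<omega>))\<^sup>2)" for \<omega>
    using d_le by (intro summable_comparison_test'[OF sums_summable[OF sums]]) auto
  have H: "H \<omega> = (\<Sum>i. (L2_norm unit_interval (d i \<omega>))\<^sup>2)" for \<omega>
    unfolding H_def using d_summable[of \<omega>]
    by (subst HS_norm_square) (simp_all add: d_def[abs_def])
  \<comment> \<open>Summing \<open>d_le\<close> over the basis: the first series is the squared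
    kernel norm by Parseval, at most \<open>C\<^sup>2\<close>.\<close>
  let ?B = "2 * C\<^sup>2 + 2 * (\<Sum>i. (L2_norm unit_interval (G (basis i)))\<^sup>2)"
  have H_le: "H \<omega> \<le> ?B" for \<omega>
  proof -
    have "H \<omega> \<le> 2 * (L2_norm unit_square (f \<omega>))\<^sup>2 + 2 * (\<Sum>i. (L2_norm unit_interval (G (basis i)))\<^sup>2)"
      unfolding H sums_unique[OF sums[of \<omega>]]
      by (intro suminf_le d_le d_summable sums_summable[OF sums])
    also have "\<dots> \<le> ?B"
      using L2_norm_family_le[of \<omega>] by (intro add_right_mono mult_left_mono power_mono) auto
    finally show ?thesis .
  qed
  have H_nonneg: "0 \<le> H \<omega>" for \<omega>
    by (simp add: H_def)
  have ennreal_H: "ennreal (H \<omega>) = (\<Sum>i. \<integral>\<^sup>+\<tau>. ennreal ((cmod (d i \<omega> \<tau>))\<^sup>2) \<partial>unit_interval)" for \<omega>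
    unfolding L2_nn_integral[OF d_L2] H by (rule suminf_ennreal2[symmetric, OF _ d_summable]) simp
  \<comment> \<open>Measurability in the frequency comes from this form, since nested nonnegative
    integrals of a jointly measurable function are measurable.\<close>
  have H_eq: "H = (\<lambda>\<omega>. enn2real (\<Sum>i. \<integral>\<^sup>+\<tau>. ennreal ((cmod (d i \<omega> \<tau>))\<^sup>2) \<partial>unit_interval))"
    unfolding ennreal_H[symmetric] using H_nonneg by simp
  have [measurable]: "H \<in> borel_measurable frequencies"
    unfolding H_eq by measurable
  have int: "integrable frequencies H"
    by (rule frequencies.integrable_const_bound[where B = ?B]) (use H_nonneg H_le in auto)
  have "M2 (\<lambda>\<omega>. integral_operator (f \<omega>)) G = (LINT \<omega>|frequencies. H \<omega>)"
    by (simp add: M2_def H_def set_integral_frequencies)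
  then have "ennreal (M2 (\<lambda>\<omega>. integral_operator (f \<omega>)) G) = (\<integral>\<^sup>+\<omega>. ennreal (H \<omega>) \<partial>frequencies)"
    using nn_integral_eq_integral[OF int] H_nonneg by simp
  also have "\<dots> = (\<Sum>i. \<integral>\<^sup>+\<omega>. \<integral>\<^sup>+\<tau>. ennreal ((cmod (d i \<omega> \<tau>))\<^sup>2) \<partial>unit_interval \<partial>frequencies)"
    unfolding ennreal_H by (rule nn_integral_suminf) measurable
  also have "\<dots> = (\<Sum>i. \<integral>\<^sup>+\<tau>. \<integral>\<^sup>+\<omega>. ennreal ((cmod (d i \<omega> \<tau>))\<^sup>2) \<partial>frequencies \<partial>unit_interval)"
    by (intro arg_cong[where f = suminf] ext frequencies_unit.Fubini'[symmetric]) measurable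
  finally show ?thesis
    by (simp add: d_def)
qed

section \<open>Optimality of the mean operator and the value of the minimum\<close>

lemma M2_nonneg: "0 \<le> M2 F G"
  unfolding M2_def set_integral_frequencies by (rule Bochner_Integration.integral_nonneg) simp

lemma M2_mean_kernel_le:
  assumes G: "hilbert_schmidt G"
  shows "M2 (\<lambda>\<omega>. integral_operator (f \<omega>)) (integral_operator (mean_kernel f)) \<le>
    M2 (\<lambda>\<omega>. integral_operator (f \<omega>)) G"
proof -
  have expand: "ennreal (M2 (\<lambda>\<omega>. integral_operator (f \<omega>)) K) =
    (\<Sum>i. \<integral>\<^sup>+\<tau>. \<integral>\<^sup>+\<omega>. ennreal ((cmod (integral_operator (f \<omega>) (basis i) \<tau> - K (basis i) \<tau>))\<^sup>2)
       \<partial>frequencies \<partial>unit_interval)" if "hilbert_schmidt K" for K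
    using that by (intro M2_eq_suminf) (auto simp: hilbert_schmidt_def basis_L2)
  have "ennreal (M2 (\<lambda>\<omega>. integral_operator (f \<omega>)) (integral_operator (mean_kernel f))) \<le>
      ennreal (M2 (\<lambda>\<omega>. integral_operator (f \<omega>)) G)"
    unfolding expand[OF G] expand[OF hilbert_schmidt_integral_operator[OF mean_kernel_L2]]
  proof (intro suminf_le nn_integral_mono_AE)
    fix i
    show "AE \<tau> in unit_interval.
      (\<integral>\<^sup>+\<omega>. ennreal ((cmod (integral_operator (f \<omega>) (basis i) \<tau> - integral_operator (mean_kernel f) (basis i) \<tau>))\<^sup>2) \<partial>frequencies)
      \<le> (\<integral>\<^sup>+\<omega>. ennreal ((cmod (integral_operator (f \<omega>) (basis i) \<tau> - G (basis i) \<tau>))\<^sup>2) \<partial>frequencies)"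
      using AE_integral_operator_mean_kernel[OF basis_L2[of i]]
    proof eventually_elim
      case (elim \<tau>)
      let ?\<phi> = "\<lambda>\<omega>. integral_operator (f \<omega>) (basis i) \<tau>"
      have \<phi>: "?\<phi> \<in> L2 frequencies"
        and m: "integral_operator (mean_kernel f) (basis i) \<tau> = (LINT \<omega>|frequencies. ?\<phi> \<omega>) / complex_of_real (2 * pi)"
        using elim by auto
      have L2: "(\<lambda>\<omega>. ?\<phi> \<omega> - c) \<in> L2 frequencies" for c
        by (intro L2_diff \<phi> frequencies.L2_const)
      show ?case
        \<comment> \<open>In the bias-variance decomposition only the squared distance to the mean
          depends on the constant: it is zero on the left and nonnegative on the right.\<close>
        unfolding L2_nn_integral[OF L2] L2_norm_square m
        using frequencies.integral_norm_diff_const_square[OF \<phi> measure_frequencies]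
        by (intro ennreal_leI) simp
    qed
  qed auto
  then show ?thesis
    by (simp add: M2_nonneg)
qed

lemma M2_mean_kernel_eq:
  "M2 (\<lambda>\<omega>. integral_operator (f \<omega>)) (integral_operator (mean_kernel f)) =
    (LINT \<sigma>|unit_interval. LINT \<tau>|unit_interval. LINT \<omega>|frequencies. (cmod (f \<omega> (\<tau>, \<sigma>)))\<^sup>2)
    - 1 / (2 * pi) * (LINT \<sigma>|unit_interval. LINT \<tau>|unit_interval. (cmod (LINT \<omega>|frequencies. f \<omega> (\<tau>, \<sigma>)))\<^sup>2)"
proof -
  let ?m = "mean_kernel f"
  note [measurable] = L2_measurable[OF mean_kernel_L2]
  let ?A = "\<lambda>x. LINT \<omega>|frequencies. (cmod (f \<omega> x))\<^sup>2"
  let ?B = "\<lambda>x. (cmod (LINT \<omega>|frequencies. f \<omega> x))\<^sup>2"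
  have intA: "integrable unit_square ?A"
    using square_frequencies.integrable_fst'[OF L2_integrable[OF frequencies_square.L2_swap[OF joint_L2]]]
    by simp
  \<comment> \<open>The mean carries 1/(2 pi), squared by the modulus; the mass 2 pi cancels one
    factor. Integrability of \<open>?B\<close> follows from that of the squared mean kernel.\<close>
  have B_eq: "2 * pi * (cmod (?m x))\<^sup>2 = 1 / (2 * pi) * ?B x" for x
    by (simp add: mean_kernel_def set_integral_frequencies norm_divide power_divide power2_eq_square field_simps)
  then have "?B x = (2 * pi)\<^sup>2 * (cmod (?m x))\<^sup>2" for x
    by (simp add: field_simps power2_eq_square)
  then have intB: "integrable unit_square ?B"
    using L2_integrable[OF mean_kernel_L2] by simp
  have "(\<integral>\<^sup>+\<omega>. \<integral>\<^sup>+x. ennreal ((norm (?m x))\<^sup>2) \<partial>unit_square \<partial>frequencies) < \<infinity>"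
    unfolding L2_nn_integral[OF mean_kernel_L2] nn_integral_const emeasure_frequencies
    by (simp add: ennreal_mult_less_top)
  then have "(\<lambda>(\<omega>, x). ?m x) \<in> L2 (frequencies \<Otimes>\<^sub>M unit_square)"
    by (intro unit_square.P.L2I_pair) auto
  from L2_diff[OF joint_L2 this]
  have diff: "(\<lambda>(\<omega>, x). f \<omega> x - ?m x) \<in> L2 (frequencies \<Otimes>\<^sub>M unit_square)"
    by (simp add: case_prod_beta')
  have "M2 (\<lambda>\<omega>. integral_operator (f \<omega>)) (integral_operator ?m) =
      (LINT \<omega>|frequencies. LINT x|unit_square. (cmod (f \<omega> x - ?m x))\<^sup>2)"
    unfolding M2_def set_integral_frequencies HS_norm_integral_operator_diff[OF family_L2 mean_kernel_L2]
      L2_norm_square ..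
  also have "\<dots> = (LINT x|unit_square. LINT \<omega>|frequencies. (cmod (f \<omega> x - ?m x))\<^sup>2)"
    using L2_integrable[OF diff] by (intro frequencies_square.Fubini_integral[symmetric]) (simp add: case_prod_beta')
  also have "\<dots> = (LINT x|unit_square. (LINT \<omega>|frequencies. (cmod (f \<omega> x))\<^sup>2) - 2 * pi * (cmod (?m x))\<^sup>2)"
  proof (rule integral_cong_AE)
    show "AE x in unit_square. (LINT \<omega>|frequencies. (cmod (f \<omega> x - ?m x))\<^sup>2) =
        (LINT \<omega>|frequencies. (cmod (f \<omega> x))\<^sup>2) - 2 * pi * (cmod (?m x))\<^sup>2"
      using square_frequencies.AE_L2_section[OF frequencies_square.L2_swap[OF joint_L2]]
    proof eventually_elim
      case (elim x)
      then have "(\<lambda>\<omega>. f \<omega> x) \<in> L2 frequencies"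
        by simp
      from frequencies.integral_norm_diff_const_square[OF this measure_frequencies, of "?m x"] show ?case
        by (simp add: mean_kernel_eq)
    qed
  qed measurable
  also have "\<dots> = (LINT x|unit_square. ?A x) - 1 / (2 * pi) * (LINT x|unit_square. ?B x)"
    using intA intB by (simp add: B_eq)
  \<comment> \<open>The stated formula integrates over \<open>\<tau>\<close> first, hence the
    second-coordinate form of Fubini.\<close>
  also have "(LINT x|unit_square. ?A x) = (LINT \<sigma>|unit_interval. LINT \<tau>|unit_interval. ?A (\<tau>, \<sigma>))"
    using unit_square.integral_snd[of "\<lambda>\<tau> \<sigma>. ?A (\<tau>, \<sigma>)"] intA by (simp add: case_prod_beta')
  also have "(LINT x|unit_square. ?B x) = (LINT \<sigma>|unit_interval. LINT \<tau>|unit_interval. ?B (\<tau>, \<sigma>))"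
    using unit_square.integral_snd[of "\<lambda>\<tau> \<sigma>. ?B (\<tau>, \<sigma>)"] intB by (simp add: case_prod_beta')
  finally show ?thesis .
qed

end

theorem lemma3p1:
  fixes P :: "'w measure"
    and X :: "int \<Rightarrow> 'w \<Rightarrow> real \<Rightarrow> real"
    and f :: "real \<Rightarrow> real \<times> real \<Rightarrow> complex"
  assumes "prob_space P"
    and "functional_time_series P X"
    and "strictly_stationary P X"
    and "integrable P (\<lambda>w. (L2_norm unit_interval (X 0 w))\<^sup>2)"
    and "(\<lambda>t. L2_norm unit_square (autocov_kernel P X t)) summable_on UNIV"
    and "spectral_density_kernel P X f"
  shows "is_arg_min (M2 (\<lambda>\<omega>. integral_operator (f \<omega>))) hilbert_schmidt
           (integral_operator (mean_kernel f)) \<and>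
    M2 (\<lambda>\<omega>. integral_operator (f \<omega>)) (integral_operator (mean_kernel f)) =
      (LINT \<sigma>|unit_interval. LINT \<tau>|unit_interval.
         (LINT \<omega>:{-pi..pi}|lborel. (cmod (f \<omega> (\<tau>, \<sigma>)))\<^sup>2))
      - 1 / (2 * pi) * (LINT \<sigma>|unit_interval. LINT \<tau>|unit_interval.
         (cmod (LINT \<omega>:{-pi..pi}|lborel. f \<omega> (\<tau>, \<sigma>)))\<^sup>2)"
proof -
  interpret bounded_kernel_family f
    "1 / (2 * pi) * (\<Sum>\<^sub>\<infinity>t. L2_norm unit_square (autocov_kernel P X t))"
  proof
    show "(\<lambda>(\<omega>, x). f \<omega> x) \<in> borel_measurable (lborel \<Otimes>\<^sub>M unit_square)" "f \<omega> \<in> L2 unit_square" for \<omega>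
      using assms(6) by (auto simp: spectral_density_kernel_def)
    show "L2_norm unit_square (f \<omega>) \<le>
        1 / (2 * pi) * (\<Sum>\<^sub>\<infinity>t. L2_norm unit_square (autocov_kernel P X t))" for \<omega>
      by (intro L2_norm_spectral_density_le autocov_kernel_L2 assms)
  qed
  show ?thesis
    \<comment> \<open>A minimiser must itself be admissible, and no admissible operator may have a
      strictly smaller value.\<close>
    using hilbert_schmidt_integral_operator[OF mean_kernel_L2] M2_mean_kernel_le M2_mean_kernel_eq
    by (auto simp: is_arg_min_def set_integral_frequencies not_less)
qed

end
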